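(* Let $a_0\in\mathcal{W}^{1,2}(\mathbb{T}^2)^3$, let $(a,\mathcal{T})$ be a maximal solution of the SRSW system with initial condition $a_0$, and for $R>0$ let $\tau_R:=\inf\{t\ge0:\|a_t\|_{1,2}>R\}$. Then $\tau_R>0$ $\mathbb{P}$-a.s. for any $R>\|a_0\|_{1,2}$. In particular $\mathcal{T}>0$ $\mathbb{P}$-a.s.
   Context: Setting. $\mathbb{T}^2$ is the two-dimensional torus and $\mathcal{W}^{k,2}$ are the standard Sobolev spaces with norms $\|\cdot\|_{k,2}$. $(\Omega,\mathcal{F},(\mathcal{F}_t)_t,\mathbb{P},(W^i)_{i\ge1})$ is a filtered probability space with complete right-continuous filtration and a sequence of independent one-dimensional $(\mathcal{F}_t)_t$-Brownian motions. Fixed data: constants $\epsilon>0$, $\mathscr{F}>0$, $f\in\mathbb{R}$, viscosities $\nu,\eta>0$; a time-independent function $b:\mathbb{T}^2\to\mathbb{R}$, $b\in\mathcal{W}^{1,2}(\mathbb{T}^2)$; a time-independent vector field $\mathcal{R}$ with $\mathrm{curl}\,\mathcal{R}=f\hat z$, chosen with $\nabla\cdot\mathcal{R}=0$. The unknown is $a=(v,h)$ with $v$ $\mathbb{R}^2$-valued and $h$ scalar; $u$ is determined by $v=\epsilon u+\mathcal{R}$; $\hat z\times u=(-u^2,u^1)$; $p=\frac{h-b}{\epsilon\mathscr{F}}$. Norms: $\|a\|_{k,2}:=\|v\|_{k,2}+\|h\|_{k,2}$. The vector fields $\xi_i:\mathbb{T}^2\to\mathbb{R}^2$, $i\ge1$,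 are time-independent, divergence-free, with $\sum_i\|\xi_i\|_{4,\infty}^2<\infty$ ($W^{4,\infty}$ norm). $\mathcal{L}_Xg:=X\cdot\nabla g$, $\mathcal{L}_i:=\mathcal{L}_{\xi_i}$, $\mathcal{A}_iv:=v^1\nabla\xi_i^1+v^2\nabla\xi_i^2$. SRSW system (Itô form): $$dv_t+\big[\mathcal{L}_{u_t}v_t+f\hat z\times u_t+\nabla p_t-\nu\Delta v_t\big]dt+\sum_{i=1}^\infty(\mathcal{L}_i+\mathcal{A}_i)v_t\,dW^i_t=\tfrac12\sum_{i=1}^\infty(\mathcal{L}_i+\mathcal{A}_i)^2v_t\,dt,$$ $$dh_t+\big[\nabla\cdot(h_tu_t)-\eta\Delta h_t\big]dt+\sum_{i=1}^\infty\mathcal{L}_ih_t\,dW^i_t=\tfrac12\sum_{i=1}^\infty\mathcal{L}_i^2h_t\,dt.$$ Local solution with initial condition $a_0$: a pair $(a,\tau)$, with $\tau:\Omega\to[0,\infty]$ a strictly positive stopping time and $a_{\cdot\wedge\tau}$ an adapted process with $a_{\cdot\wedge\tau}\in L^2(\Omega;C([0,T];\mathcal{W}^{1,2}(\mathbb{T}^2)^3))\cap L^2(\Omega;L^2(0,T;\mathcal{W}^{2,2}(\mathbb{T}^2)^3))$ for all $T>0$ (the second membership understood as $\mathbb{E}\int_0^{T\wedge\tau}\|a_s\|_{2,2}^2ds<\infty$), satisfying the time-integrated Itô system on $[0,t\wedge\tau]$ for all $t\ge0$, $\mathbb{P}$-a.s., as an identity in $L^2(\mathbb{T}^2)^3$.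 Maximal solution: a pair $(a,\mathcal{T})$, with $\mathcal{T}:\Omega\to[0,\infty]$ a stopping time and $a$ a process on $[0,\mathcal{T})$, for which there is an increasing sequence of stopping times $(\tau^n)_n$ such that: (i) $\mathcal{T}=\lim_n\tau^n$ and $\mathbb{P}(\mathcal{T}>0)=1$; (ii) $(a,\tau^n)$ is a local solution for every $n$; (iii) if $\mathcal{T}<\infty$ then $\limsup_{t\to\mathcal{T}}\|a_t\|_{1,2}=\infty$. In the definition of $\tau_R$ the infimum is over $t\in[0,\mathcal{T})$ and $\inf\emptyset=\infty$. *)

theory Defs
  imports "HOL-Probability.Probability"
begin

section \<open>The Hilbert space of square-integrable functions on the torus\<close>

(* Functions on the torus R^2/Z^2 are represented by Z^2-periodic functions on the plane;
   unit_cell is a fundamental domain. *)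

definition unit_cell :: "(real^2) set"
  where "unit_cell = {x. \<forall>i. 0 \<le> x$i \<and> x$i < 1}"

abbreviation torus_measure :: "(real^2) measure"
  where "torus_measure \<equiv> restrict_space lborel unit_cell"

definition lattice_periodic :: "(real^2 \<Rightarrow> 'b) \<Rightarrow> bool"
  where "lattice_periodic F \<longleftrightarrow> (\<forall>x i. F (x + axis i 1) = F x)"

definition square_integrable :: "(real^2 \<Rightarrow> real) set"
  where "square_integrable = {F. lattice_periodic F \<and> F \<in> borel_measurable borel \<and>
    integrable torus_measure (\<lambda>x. (F x)\<^sup>2)}"

lemma unit_cell_sets [measurable]: "unit_cell \<in> sets borel"
  unfolding unit_cell_def by measurable

lemma unit_cell_eq_subset: "unit_cell \<subseteq> cbox 0 1"
  by (auto simp: unit_cell_def mem_box_cart less_imp_le)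

lemma finite_torus_measure: "finite_measure torus_measure"
proof
  have "emeasure lborel unit_cell \<le> emeasure lborel (cbox 0 (1::real^2))"
    by (intro emeasure_mono unit_cell_eq_subset) auto
  also have "\<dots> < \<infinity>" by (simp add: emeasure_lborel_cbox_eq)
  finally show "emeasure torus_measure (space torus_measure) \<noteq> \<infinity>"
    by (auto simp: space_restrict_space emeasure_restrict_space)
qed

interpretation torus: finite_measure torus_measure
  by (rule finite_torus_measure)

lemma square_integrableD:
  assumes "F \<in> square_integrable"
  shows "F \<in> borel_measurable borel" "F \<in> borel_measurable torus_measure"
    "integrable torus_measure (\<lambda>x. (F x)\<^sup>2)" "lattice_periodic F"
  using assms by (auto simp: square_integrable_def intro!: measurable_restrict_space1)

lemma square_integrable_mult:
  assumes "F \<in> square_integrable" "G \<in> square_integrable"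
  shows "integrable torus_measure (\<lambda>x. F x * G x)"
proof (rule Bochner_Integration.integrable_bound)
  show "integrable torus_measure (\<lambda>x. (F x)\<^sup>2 + (G x)\<^sup>2)"
    using square_integrableD[OF assms(1)] square_integrableD[OF assms(2)] by simp
  show "(\<lambda>x. F x * G x) \<in> borel_measurable torus_measure"
    using square_integrableD[OF assms(1)] square_integrableD[OF assms(2)] by simp
  have "\<bar>F x * G x\<bar> \<le> (F x)\<^sup>2 + (G x)\<^sup>2" for x
  proof -
    have "0 \<le> (\<bar>F x\<bar> - \<bar>G x\<bar>)\<^sup>2" by simp
    then have "2 * (\<bar>F x\<bar> * \<bar>G x\<bar>) \<le> (F x)\<^sup>2 + (G x)\<^sup>2" by (simp add: power2_diff)
    moreover have "0 \<le> \<bar>F x\<bar> * \<bar>G x\<bar>" by simp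
    ultimately show ?thesis unfolding abs_mult by linarith
  qed
  then show "AE x in torus_measure. norm (F x * G x) \<le> norm ((F x)\<^sup>2 + (G x)\<^sup>2)" by simp
qed

lemma square_integrable_0: "(\<lambda>x. 0) \<in> square_integrable"
  by (simp add: square_integrable_def lattice_periodic_def)

lemma square_integrable_add:
  assumes "F \<in> square_integrable" "G \<in> square_integrable"
  shows "(\<lambda>x. F x + G x) \<in> square_integrable"
  using square_integrableD[OF assms(1)] square_integrableD[OF assms(2)]
    square_integrable_mult[OF assms]
  by (auto simp: square_integrable_def lattice_periodic_def power2_sum mult.assoc)

lemma square_integrable_scale:
  assumes "F \<in> square_integrable"
  shows "(\<lambda>x. c * F x) \<in> square_integrable"
  using square_integrableD[OF assms(1)]
  by (auto simp: square_integrable_def lattice_periodic_def power_mult_distrib)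

lemma square_integrable_uminus:
  assumes "F \<in> square_integrable"
  shows "(\<lambda>x. - F x) \<in> square_integrable"
  using square_integrable_scale[OF assms, of "-1"] by simp

(* The real Hilbert space L^2(R^2/Z^2), modulo equality almost everywhere. *)

quotient_type torus_L2 = "real^2 \<Rightarrow> real" / partial:
  "\<lambda>F G. F \<in> square_integrable \<and> G \<in> square_integrable \<and> (AE x in torus_measure. F x = G x)"
proof (rule part_equivpI)
  show "\<exists>F. F \<in> square_integrable \<and> F \<in> square_integrable \<and> (AE x in torus_measure. F x = F x)"
    using square_integrable_0 by auto
  show "symp (\<lambda>F G. F \<in> square_integrable \<and> G \<in> square_integrable \<and> (AE x in torus_measure. F x = G x))"
    by (auto simp: symp_def)
  show "transp (\<lambda>F G. F \<in> square_integrable \<and> G \<in> square_integrable \<and> (AE x in torus_measure. F x = G x))"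
    unfolding transp_def by (auto elim: eventually_elim2)
qed

instantiation torus_L2 :: real_inner
begin

lift_definition zero_torus_L2 :: torus_L2 is "\<lambda>x. 0"
  by (auto simp: square_integrable_0)

lift_definition plus_torus_L2 :: "torus_L2 \<Rightarrow> torus_L2 \<Rightarrow> torus_L2" is "\<lambda>F G x. F x + G x"
  by (auto simp: square_integrable_add elim: eventually_elim2)

lift_definition uminus_torus_L2 :: "torus_L2 \<Rightarrow> torus_L2" is "\<lambda>F x. - F x"
  by (auto simp: square_integrable_uminus)

lift_definition scaleR_torus_L2 :: "real \<Rightarrow> torus_L2 \<Rightarrow> torus_L2" is "\<lambda>c F x. c * F x"
  by (auto simp: square_integrable_scale)

lift_definition inner_torus_L2 :: "torus_L2 \<Rightarrow> torus_L2 \<Rightarrow> real"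
  is "\<lambda>F G. \<integral>x. F x * G x \<partial>torus_measure"
  by (rule integral_cong_AE)
    (auto dest: square_integrableD intro!: borel_measurable_times elim: eventually_elim2)

definition "minus_torus_L2 f g = f + - (g::torus_L2)"
definition "norm_torus_L2 (f::torus_L2) = sqrt (inner f f)"
definition "dist_torus_L2 f (g::torus_L2) = norm (f - g)"
definition "sgn_torus_L2 (f::torus_L2) = inverse (norm f) *\<^sub>R f"
definition "uniformity_torus_L2 = (INF e\<in>{0<..}. principal {(x::torus_L2, y). dist x y < e})"
definition "open_torus_L2 (U::torus_L2 set) =
  (\<forall>x\<in>U. eventually (\<lambda>(x', y). x' = x \<longrightarrow> y \<in> U) uniformity)"

instance
proof
  fix f g h :: torus_L2 and r s :: real
  show "f + g + h = f + (g + h)"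
    by transfer (auto intro!: square_integrable_add simp: add.assoc)
  show "f + g = g + f"
    by transfer (auto intro!: square_integrable_add simp: add.commute)
  show "0 + f = f"
    by transfer auto
  show "- f + f = 0"
    by transfer (auto simp: square_integrable_0)
  show "f - g = f + - g"
    by (simp add: minus_torus_L2_def)
  show "r *\<^sub>R (f + g) = r *\<^sub>R f + r *\<^sub>R g"
    by transfer (auto intro!: square_integrable_add square_integrable_scale simp: distrib_left)
  show "(r + s) *\<^sub>R f = r *\<^sub>R f + s *\<^sub>R f"
    by transfer (auto intro!: square_integrable_add square_integrable_scale simp: distrib_right)
  show "r *\<^sub>R s *\<^sub>R f = (r * s) *\<^sub>R f"
    by transfer (auto intro!: square_integrable_scale simp: mult.assoc)
  show "1 *\<^sub>R f = f"
    by transfer auto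
  show "dist f g = norm (f - g)"
    by (simp add: dist_torus_L2_def)
  show "sgn f = inverse (norm f) *\<^sub>R f"
    by (simp add: sgn_torus_L2_def)
  show "uniformity = (INF e\<in>{0<..}. principal {(x::torus_L2, y). dist x y < e})"
    by (simp add: uniformity_torus_L2_def)
  show "open U = (\<forall>x\<in>U. eventually (\<lambda>(x', y). x' = x \<longrightarrow> y \<in> U) uniformity)" for U :: "torus_L2 set"
    by (simp add: open_torus_L2_def)
  show "norm f = sqrt (inner f f)"
    by (simp add: norm_torus_L2_def)
  show "inner f g = inner g f"
    by transfer (simp add: mult.commute)
  show "inner (f + g) h = inner f h + inner g h"
    by transfer (auto simp: distrib_right square_integrable_mult)
  show "inner (r *\<^sub>R f) g = r * inner f g"
    by transfer (simp add: mult.assoc)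
  show "0 \<le> inner f f"
    by transfer simp
  show "inner f f = 0 \<longleftrightarrow> f = 0"
  proof transfer
    fix f :: "real^2 \<Rightarrow> real"
    assume f: "f \<in> square_integrable \<and> f \<in> square_integrable \<and> (AE x in torus_measure. f x = f x)"
    have "(\<integral>x. f x * f x \<partial>torus_measure) = 0 \<longleftrightarrow> (AE x in torus_measure. f x * f x = 0)"
      using f by (intro integral_nonneg_eq_0_iff_AE square_integrable_mult) auto
    then show "(\<integral>x. f x * f x \<partial>torus_measure) = 0 \<longleftrightarrow>
        f \<in> square_integrable \<and> (\<lambda>x. 0) \<in> square_integrable \<and> (AE x in torus_measure. f x = 0)"
      using f by (simp add: square_integrable_0)
  qed
qed

end

lemma rep_torus_L2_square_integrable: "rep_torus_L2 f \<in> square_integrable"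
  using Quotient_rep_reflp[OF Quotient_torus_L2] by auto

lemma abs_rep_torus_L2: "abs_torus_L2 (rep_torus_L2 f) = f"
  using Quotient_abs_rep[OF Quotient_torus_L2] .

lemma rep_abs_torus_L2:
  assumes "F \<in> square_integrable"
  shows "AE x in torus_measure. rep_torus_L2 (abs_torus_L2 F) x = F x"
  using Quotient_rep_abs[OF Quotient_torus_L2, of F] assms by auto

lemma abs_torus_L2_eqI:
  assumes "F \<in> square_integrable" "G \<in> square_integrable" "AE x in torus_measure. F x = G x"
  shows "abs_torus_L2 F = abs_torus_L2 G"
  using Quotient_rel_abs[OF Quotient_torus_L2, of F G] assms by auto

lemma norm_abs_torus_L2:
  assumes "F \<in> square_integrable"
  shows "(norm (abs_torus_L2 F))\<^sup>2 = (\<integral>x. (F x)\<^sup>2 \<partial>torus_measure)"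
proof -
  have "(norm (abs_torus_L2 F))\<^sup>2 = inner (abs_torus_L2 F) (abs_torus_L2 F)"
    by (simp add: power2_norm_eq_inner)
  also have "\<dots> = (\<integral>x. (F x)\<^sup>2 \<partial>torus_measure)"
    using assms by (subst inner_torus_L2.abs_eq) (auto simp: power2_eq_square)
  finally show ?thesis .
qed

lemma abs_torus_L2_add:
  assumes "F \<in> square_integrable" "G \<in> square_integrable"
  shows "abs_torus_L2 F + abs_torus_L2 G = abs_torus_L2 (\<lambda>x. F x + G x)"
  using assms by (subst plus_torus_L2.abs_eq) auto

lemma abs_torus_L2_scaleR:
  assumes "F \<in> square_integrable"
  shows "c *\<^sub>R abs_torus_L2 F = abs_torus_L2 (\<lambda>x. c * F x)"
  using assms by (subst scaleR_torus_L2.abs_eq) auto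

lemma square_integrable_diff:
  assumes "F \<in> square_integrable" "G \<in> square_integrable"
  shows "(\<lambda>x. F x - G x) \<in> square_integrable"
  using square_integrable_add[OF assms(1) square_integrable_uminus[OF assms(2)]] by simp

lemma abs_torus_L2_diff:
  assumes "F \<in> square_integrable" "G \<in> square_integrable"
  shows "abs_torus_L2 F - abs_torus_L2 G = abs_torus_L2 (\<lambda>x. F x - G x)"
proof -
  have "abs_torus_L2 F - abs_torus_L2 G = abs_torus_L2 F + (-1) *\<^sub>R abs_torus_L2 G" by simp
  also have "\<dots> = abs_torus_L2 (\<lambda>x. F x + (-1) * G x)"
    by (simp only: abs_torus_L2_scaleR[OF assms(2)] abs_torus_L2_add[OF assms(1) square_integrable_scale[OF assms(2)]])
  finally show ?thesis by simp
qed

lemma norm_diff_torus_L2: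
  "(norm (f - g))\<^sup>2 = (\<integral>x. (rep_torus_L2 f x - rep_torus_L2 g x)\<^sup>2 \<partial>torus_measure)"
  using norm_abs_torus_L2[OF square_integrable_diff, of "rep_torus_L2 f" "rep_torus_L2 g"]
    abs_torus_L2_diff[of "rep_torus_L2 f" "rep_torus_L2 g"]
  by (simp add: rep_torus_L2_square_integrable abs_rep_torus_L2)

lemma nn_norm_diff_torus_L2:
  "(\<integral>\<^sup>+x. ennreal ((rep_torus_L2 f x - rep_torus_L2 g x)\<^sup>2) \<partial>torus_measure) = ennreal ((norm (f - g))\<^sup>2)"
  unfolding norm_diff_torus_L2
  by (rule nn_integral_eq_integral)
    (auto intro!: square_integrableD(3) square_integrable_diff rep_torus_L2_square_integrable)

lemma square_integrable_const: "(\<lambda>x. c) \<in> square_integrable"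
  by (simp add: square_integrable_def lattice_periodic_def)

lemma square_integrable_abs:
  assumes "F \<in> square_integrable"
  shows "(\<lambda>x. \<bar>F x\<bar>) \<in> square_integrable"
  using assms by (auto simp: square_integrable_def lattice_periodic_def)

lemma integral_abs_le_norm:
  assumes "F \<in> square_integrable"
  shows "(\<integral>\<^sup>+x. ennreal \<bar>F x\<bar> \<partial>torus_measure) \<le> ennreal (norm (abs_torus_L2 F) * norm (abs_torus_L2 (\<lambda>x. 1)))"
proof -
  note A = square_integrable_abs[OF assms]
  have "integrable torus_measure (\<lambda>x. \<bar>F x\<bar> * 1)"
    by (rule square_integrable_mult[OF A square_integrable_const])
  then have "(\<integral>\<^sup>+x. ennreal \<bar>F x\<bar> \<partial>torus_measure) = ennreal (\<integral>x. \<bar>F x\<bar> * 1 \<partial>torus_measure)"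
    by (subst nn_integral_eq_integral) auto
  also have "(\<integral>x. \<bar>F x\<bar> * 1 \<partial>torus_measure) = inner (abs_torus_L2 (\<lambda>x. \<bar>F x\<bar>)) (abs_torus_L2 (\<lambda>x. 1))"
    using A square_integrable_const by (subst inner_torus_L2.abs_eq) auto
  also have "ennreal \<dots> \<le> ennreal (norm (abs_torus_L2 (\<lambda>x. \<bar>F x\<bar>)) * norm (abs_torus_L2 (\<lambda>x. 1)))"
    by (intro ennreal_leI norm_cauchy_schwarz)
  also have "norm (abs_torus_L2 (\<lambda>x. \<bar>F x\<bar>)) = norm (abs_torus_L2 F)"
    by (rule power2_eq_imp_eq) (simp_all add: norm_abs_torus_L2[OF A] norm_abs_torus_L2[OF assms])
  finally show ?thesis .
qed

lemma torus_L2_Cauchy_convergent: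
  fixes X :: "nat \<Rightarrow> torus_L2"
  assumes "Cauchy X"
  shows "convergent X"
proof -
  have "\<forall>k. \<exists>N. \<forall>m\<ge>N. \<forall>n\<ge>N. dist (X m) (X n) < (1/2)^k"
    using assms by (intro allI metric_CauchyD) auto
  then obtain N where N: "\<And>k m n. m \<ge> N k \<Longrightarrow> n \<ge> N k \<Longrightarrow> dist (X m) (X n) < (1/2)^k"
    by metis
  define r where "r n = (\<Sum>k\<le>n. N k) + n" for n
  have rN: "N n \<le> r n" for n
    unfolding r_def by (rule trans_le_add1) (auto intro!: member_le_sum)
  have r: "strict_mono r"
    by (rule strict_mono_Suc_iff[THEN iffD2]) (simp add: r_def)
  define f where "f n = rep_torus_L2 (X (r n))" for n
  have f_sq: "f n \<in> square_integrable" for n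
    by (simp add: f_def rep_torus_L2_square_integrable)
  have f_borel [measurable]: "f n \<in> borel_measurable borel" for n
    using square_integrableD(1)[OF f_sq] .
  have f_tm [measurable]: "f n \<in> borel_measurable torus_measure" for n
    using square_integrableD(2)[OF f_sq] .
  define C where "C = norm (abs_torus_L2 (\<lambda>x. 1))"
  have C0: "0 \<le> C" by (simp add: C_def)
  have step: "(\<integral>\<^sup>+x. ennreal \<bar>f (Suc n) x - f n x\<bar> \<partial>torus_measure) \<le> ennreal (C * (1/2)^n)" for n
  proof -
    have "(\<integral>\<^sup>+x. ennreal \<bar>f (Suc n) x - f n x\<bar> \<partial>torus_measure)
      \<le> ennreal (norm (abs_torus_L2 (\<lambda>x. f (Suc n) x - f n x)) * C)"
      unfolding C_def by (rule integral_abs_le_norm[OF square_integrable_diff[OF f_sq f_sq]])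
    also have "abs_torus_L2 (\<lambda>x. f (Suc n) x - f n x) = X (r (Suc n)) - X (r n)"
      unfolding f_def
      by (subst abs_torus_L2_diff[symmetric]) (simp_all add: rep_torus_L2_square_integrable abs_rep_torus_L2)
    also have "ennreal (norm (X (r (Suc n)) - X (r n)) * C) \<le> ennreal (C * (1/2)^n)"
    proof (rule ennreal_leI)
      have "N n \<le> r (Suc n)"
        using rN[of n] strict_monoD[OF r, of n "Suc n"] by simp
      then have "norm (X (r (Suc n)) - X (r n)) \<le> (1/2)^n"
        using N[of n "r (Suc n)" "r n"] rN[of n] by (simp add: dist_norm)
      then show "norm (X (r (Suc n)) - X (r n)) * C \<le> C * (1/2)^n"
        using C0 by (metis mult.commute mult_left_mono)
    qed
    finally show ?thesis .
  qed
  have "(\<integral>\<^sup>+x. (\<Sum>n. ennreal \<bar>f (Suc n) x - f n x\<bar>) \<partial>torus_measure) =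
      (\<Sum>n. \<integral>\<^sup>+x. ennreal \<bar>f (Suc n) x - f n x\<bar> \<partial>torus_measure)"
    by (rule nn_integral_suminf) measurable
  also have "\<dots> \<le> (\<Sum>n. ennreal (C * (1/2)^n))"
    by (rule suminf_le) (auto intro: step)
  also have "\<dots> = ennreal (\<Sum>n. C * (1/2)^n)"
    using C0 by (intro suminf_ennreal2) (auto intro!: summable_mult summable_geometric)
  finally have "(\<integral>\<^sup>+x. (\<Sum>n. ennreal \<bar>f (Suc n) x - f n x\<bar>) \<partial>torus_measure) \<noteq> \<infinity>"
    by (auto simp: top_unique)
  then have "AE x in torus_measure. (\<Sum>n. ennreal \<bar>f (Suc n) x - f n x\<bar>) \<noteq> \<infinity>"
    by (intro nn_integral_PInf_AE) auto
  then have conv: "AE x in torus_measure. (\<lambda>n. f n x) \<longlonglongrightarrow> lim (\<lambda>n. f n x)"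
  proof eventually_elim
    case (elim x)
    have "summable (\<lambda>n. \<bar>f (Suc n) x - f n x\<bar>)"
      using elim by (intro summable_suminf_not_top) auto
    then have "summable (\<lambda>n. f (Suc n) x - f n x)"
      by (rule summable_rabs_cancel)
    then have "convergent (\<lambda>n. \<Sum>k<n. f (Suc k) x - f k x)"
      by (simp add: summable_iff_convergent)
    then have "convergent (\<lambda>n. f n x - f 0 x)"
      using sum_lessThan_telescope[of "\<lambda>k. f k x"] by simp
    then have "convergent (\<lambda>n. (f n x - f 0 x) + f 0 x)"
      by (intro convergent_add convergent_const)
    then show ?case by (simp add: convergent_LIMSEQ_iff)
  qed
  define l where "l x = lim (\<lambda>n. f n x)" for x
  have l_borel [measurable]: "l \<in> borel_measurable borel"
    unfolding l_def by measurable
  have l_tm [measurable]: "l \<in> borel_measurable torus_measure"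
    by (rule measurable_restrict_space1) simp
  have l_per: "lattice_periodic l"
    using square_integrableD(4)[OF f_sq] by (simp add: lattice_periodic_def l_def)
  have fatou: "(\<integral>\<^sup>+x. ennreal ((l x - f n x)\<^sup>2) \<partial>torus_measure) \<le> ennreal (e\<^sup>2)"
    if e: "\<And>m. m \<ge> M \<Longrightarrow> norm (X (r m) - X (r n)) \<le> e" for n M e
  proof -
    have "(\<integral>\<^sup>+x. ennreal ((l x - f n x)\<^sup>2) \<partial>torus_measure) =
        (\<integral>\<^sup>+x. liminf (\<lambda>m. ennreal ((f m x - f n x)\<^sup>2)) \<partial>torus_measure)"
    proof (rule nn_integral_cong_AE, use conv in eventually_elim)
      case (elim x)
      then have "(\<lambda>m. ennreal ((f m x - f n x)\<^sup>2)) \<longlonglongrightarrow> ennreal ((l x - f n x)\<^sup>2)"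
        unfolding l_def by (intro tendsto_intros) auto
      then show ?case by (intro lim_imp_Liminf[symmetric]) auto
    qed
    also have "\<dots> \<le> liminf (\<lambda>m. \<integral>\<^sup>+x. ennreal ((f m x - f n x)\<^sup>2) \<partial>torus_measure)"
      by (rule nn_integral_liminf) measurable
    also have "\<dots> \<le> liminf (\<lambda>m. ennreal (e\<^sup>2))"
    proof (rule Liminf_mono)
      show "\<forall>\<^sub>F m in sequentially.
          (\<integral>\<^sup>+x. ennreal ((f m x - f n x)\<^sup>2) \<partial>torus_measure) \<le> ennreal (e\<^sup>2)"
        using eventually_ge_at_top[of M]
      proof eventually_elim
        case (elim m)
        then show ?case
          unfolding f_def nn_norm_diff_torus_L2 by (intro ennreal_leI power_mono e) auto
      qed
    qed
    also have "\<dots> = ennreal (e\<^sup>2)" by (simp add: Liminf_const)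
    finally show ?thesis .
  qed
  have cauchy_r: "\<exists>M. \<forall>m\<ge>M. \<forall>n\<ge>M. norm (X (r m) - X (r n)) \<le> e" if e: "e > 0" for e
  proof -
    obtain M where "\<forall>m\<ge>M. \<forall>n\<ge>M. dist (X m) (X n) < e"
      using metric_CauchyD[OF assms e] by blast
    moreover have "n \<le> r n" for n
      by (rule seq_suble[OF r])
    ultimately show ?thesis
      unfolding dist_norm by (meson less_imp_le order_trans)
  qed
  have diff_sq: "(\<lambda>x. l x - f n x) \<in> square_integrable"
    if "(\<integral>\<^sup>+x. ennreal ((l x - f n x)\<^sup>2) \<partial>torus_measure) \<le> ennreal (e\<^sup>2)" for n e
  proof -
    have "integrable torus_measure (\<lambda>x. (l x - f n x)\<^sup>2)"
    proof (rule integrableI_bounded)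
      have "(\<integral>\<^sup>+x. ennreal (norm ((l x - f n x)\<^sup>2)) \<partial>torus_measure) \<le> ennreal (e\<^sup>2)"
        using that by simp
      also have "\<dots> < \<infinity>" by simp
      finally show "(\<integral>\<^sup>+x. ennreal (norm ((l x - f n x)\<^sup>2)) \<partial>torus_measure) < \<infinity>" .
    qed measurable
    then show ?thesis
      using l_per square_integrableD(4)[OF f_sq[of n]]
      by (auto simp: square_integrable_def lattice_periodic_def)
  qed
  obtain M0 where M0: "\<And>m n. m \<ge> M0 \<Longrightarrow> n \<ge> M0 \<Longrightarrow> norm (X (r m) - X (r n)) \<le> 1"
    using cauchy_r[of 1] by auto
  have "(\<lambda>x. (l x - f M0 x) + f M0 x) \<in> square_integrable"
    by (rule square_integrable_add[OF diff_sq[OF fatou[of M0 M0 1]] f_sq]) (auto intro: M0)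
  then have l_sq: "l \<in> square_integrable" by simp
  have "(\<lambda>n. X (r n)) \<longlonglongrightarrow> abs_torus_L2 l"
  proof (rule LIMSEQ_I)
    fix e :: real assume "e > 0"
    then obtain M where M: "\<And>m n. m \<ge> M \<Longrightarrow> n \<ge> M \<Longrightarrow> norm (X (r m) - X (r n)) \<le> e / 2"
      using cauchy_r[of "e / 2"] by auto
    have "norm (X (r n) - abs_torus_L2 l) < e" if "n \<ge> M" for n
    proof -
      have X: "X (r n) = abs_torus_L2 (f n)" by (simp add: f_def abs_rep_torus_L2)
      have "norm (X (r n) - abs_torus_L2 l) = norm (abs_torus_L2 (\<lambda>x. l x - f n x))"
        unfolding X by (simp add: abs_torus_L2_diff[symmetric] l_sq f_sq norm_minus_commute)
      moreover have "ennreal ((norm (abs_torus_L2 (\<lambda>x. l x - f n x)))\<^sup>2) \<le> ennreal ((e / 2)\<^sup>2)"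
      proof -
        have "(\<lambda>x. l x - f n x) \<in> square_integrable" by (rule square_integrable_diff[OF l_sq f_sq])
        then have "ennreal ((norm (abs_torus_L2 (\<lambda>x. l x - f n x)))\<^sup>2) =
            (\<integral>\<^sup>+x. ennreal ((l x - f n x)\<^sup>2) \<partial>torus_measure)"
          by (subst norm_abs_torus_L2) (auto intro!: nn_integral_eq_integral[symmetric] dest: square_integrableD(3))
        also have "\<dots> \<le> ennreal ((e / 2)\<^sup>2)"
          by (rule fatou[of M]) (use M that in auto)
        finally show ?thesis .
      qed
      then have "norm (abs_torus_L2 (\<lambda>x. l x - f n x)) \<le> e / 2"
        using \<open>e > 0\<close> by - (rule power2_le_imp_le, simp_all add: ennreal_le_iff)
      ultimately show ?thesis using \<open>e > 0\<close> by simp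
    qed
    then show "\<exists>no. \<forall>n\<ge>no. norm (X (r n) - abs_torus_L2 l) < e" by blast
  qed
  then have "X \<longlonglongrightarrow> abs_torus_L2 l"
    using Cauchy_converges_subseq[OF assms r] by (simp add: comp_def)
  then show ?thesis by (rule convergentI)
qed

instance torus_L2 :: banach
  by standard (rule torus_L2_Cauchy_convergent)

definition periodize :: "(real^2 \<Rightarrow> 'b) \<Rightarrow> real^2 \<Rightarrow> 'b"
  where "periodize F x = F (\<chi> i. frac (x$i))"

(* The class in L^2 of the restriction of F to the unit cell; 0 if F is not square-integrable there. *)

definition torus_class :: "(real^2 \<Rightarrow> real) \<Rightarrow> torus_L2"
  where "torus_class F = (if periodize F \<in> square_integrable then abs_torus_L2 (periodize F) else 0)"

lemma measurable_vec_frac [measurable]: "(\<lambda>x::real^2. \<chi> i. frac (x$i)) \<in> borel_measurable borel"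
proof (subst borel_measurable_euclidean_space, rule ballI)
  fix b :: "real^2" assume "b \<in> Basis"
  then obtain i where b: "b = axis i 1" by (auto simp: Basis_vec_def)
  have "(\<lambda>x::real^2. x$i - real_of_int \<lfloor>x$i\<rfloor>) \<in> borel_measurable borel"
    by measurable
  then show "(\<lambda>x::real^2. (\<chi> i. frac (x$i)) \<bullet> b) \<in> borel_measurable borel"
    by (simp add: b inner_axis frac_def)
qed

lemma periodize_borel [measurable (raw)]:
  assumes "F \<in> borel_measurable borel"
  shows "periodize F \<in> borel_measurable borel"
  unfolding periodize_def by (rule measurable_compose[OF measurable_vec_frac assms])

lemma lattice_periodic_periodize: "lattice_periodic (periodize F)"
proof -
  have "frac ((x + axis i 1)$j) = frac (x$j)" for x :: "real^2" and i j
    by (auto simp: axis_def frac_def)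
  then show ?thesis by (simp add: lattice_periodic_def periodize_def)
qed

lemma periodize_cell: "x \<in> unit_cell \<Longrightarrow> periodize F x = F x"
  by (simp add: periodize_def unit_cell_def frac_eq[THEN iffD2] vec_eq_iff)

lemma AE_periodize: "AE x in torus_measure. periodize F x = F x"
  by (auto simp: periodize_cell AE_restrict_space_iff)

lemma periodize_square_integrable:
  assumes [measurable]: "F \<in> borel_measurable borel" and "integrable torus_measure (\<lambda>x. (F x)\<^sup>2)"
  shows "periodize F \<in> square_integrable"
proof -
  have "integrable torus_measure (\<lambda>x. (periodize F x)\<^sup>2) = integrable torus_measure (\<lambda>x. (F x)\<^sup>2)"
    by (rule Bochner_Integration.integrable_cong) (simp_all add: periodize_cell space_restrict_space)
  then show ?thesis
    using assms by (simp add: square_integrable_def lattice_periodic_periodize periodize_borel)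
qed

lemma torus_class_rep: "torus_class (rep_torus_L2 f) = f"
proof -
  have *: "periodize (rep_torus_L2 f) \<in> square_integrable"
    using square_integrableD[OF rep_torus_L2_square_integrable[of f]]
    by (intro periodize_square_integrable) auto
  have "abs_torus_L2 (periodize (rep_torus_L2 f)) = abs_torus_L2 (rep_torus_L2 f)"
    by (rule abs_torus_L2_eqI[OF * rep_torus_L2_square_integrable AE_periodize])
  then show ?thesis by (simp add: torus_class_def * abs_rep_torus_L2)
qed

lemma torus_class_add:
  assumes [measurable]: "F \<in> borel_measurable borel" "G \<in> borel_measurable borel"
    and "integrable torus_measure (\<lambda>x. (F x)\<^sup>2)" "integrable torus_measure (\<lambda>x. (G x)\<^sup>2)"
  shows "torus_class (\<lambda>x. F x + G x) = torus_class F + torus_class G"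
proof -
  note F = periodize_square_integrable[OF assms(1,3)] and G = periodize_square_integrable[OF assms(2,4)]
  have "periodize (\<lambda>x. F x + G x) = (\<lambda>x. periodize F x + periodize G x)"
    by (simp add: periodize_def fun_eq_iff)
  then show ?thesis
    using F G square_integrable_add[OF F G] by (simp add: torus_class_def abs_torus_L2_add)
qed

lemma torus_class_scaleR:
  assumes [measurable]: "F \<in> borel_measurable borel" and "integrable torus_measure (\<lambda>x. (F x)\<^sup>2)"
  shows "torus_class (\<lambda>x. c * F x) = c *\<^sub>R torus_class F"
proof -
  note F = periodize_square_integrable[OF assms]
  have "periodize (\<lambda>x. c * F x) = (\<lambda>x. c * periodize F x)"
    by (simp add: periodize_def fun_eq_iff)
  then show ?thesis
    using F square_integrable_scale[OF F] by (simp add: torus_class_def abs_torus_L2_scaleR)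
qed

lemma torus_class_diff:
  assumes [measurable]: "F \<in> borel_measurable borel" "G \<in> borel_measurable borel"
    and "integrable torus_measure (\<lambda>x. (F x)\<^sup>2)" "integrable torus_measure (\<lambda>x. (G x)\<^sup>2)"
  shows "torus_class (\<lambda>x. F x - G x) = torus_class F - torus_class G"
  using torus_class_add[of F "\<lambda>x. (-1) * G x"] torus_class_scaleR[of G "-1"] assms by simp

lemma norm_torus_class:
  assumes [measurable]: "F \<in> borel_measurable borel" and "integrable torus_measure (\<lambda>x. (F x)\<^sup>2)"
  shows "(norm (torus_class F))\<^sup>2 = (\<integral>x. (F x)\<^sup>2 \<partial>torus_measure)"
proof -
  have "(\<integral>x. (periodize F x)\<^sup>2 \<partial>torus_measure) = (\<integral>x. (F x)\<^sup>2 \<partial>torus_measure)"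
    by (rule Bochner_Integration.integral_cong) (simp_all add: periodize_cell space_restrict_space)
  then show ?thesis
    using periodize_square_integrable[OF assms] by (simp add: torus_class_def norm_abs_torus_L2)
qed

lemma torus_class_0: "torus_class (\<lambda>x. 0) = 0"
  using torus_class_scaleR[of "\<lambda>x. 0" 0] by simp

lemma torus_class_indicator_empty: "torus_class (indicator {}) = 0"
proof -
  have "(indicator {} :: real^2 \<Rightarrow> real) = (\<lambda>x. 0)" by (simp add: fun_eq_iff)
  then show ?thesis by (simp add: torus_class_0)
qed

lemma torus_class_dominated:
  assumes U [measurable]: "\<And>n. U n \<in> borel_measurable borel" and V [measurable]: "V \<in> borel_measurable borel"
    and V2: "integrable torus_measure (\<lambda>x. (V x)\<^sup>2)"
    and le: "\<And>n x. \<bar>U n x\<bar> \<le> V x" and lim: "\<And>x. (\<lambda>n. U n x) \<longlonglongrightarrow> u x"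
  shows "(\<lambda>n. torus_class (U n)) \<longlonglongrightarrow> torus_class u"
proof -
  have u [measurable]: "u \<in> borel_measurable borel"
    by (rule borel_measurable_LIMSEQ_real[OF lim U])
  have [measurable]: "U n \<in> borel_measurable torus_measure" "V \<in> borel_measurable torus_measure"
    "u \<in> borel_measurable torus_measure" for n
    by (auto intro!: measurable_restrict_space1)
  have le': "\<bar>u x\<bar> \<le> V x" for x
    by (rule tendsto_upperbound[OF tendsto_rabs[OF lim]]) (auto simp: le)
  have sq: "integrable torus_measure (\<lambda>x. (W x)\<^sup>2)"
    if [measurable]: "W \<in> borel_measurable torus_measure" and W: "\<And>x. \<bar>W x\<bar> \<le> V x" for W
  proof (rule Bochner_Integration.integrable_bound[OF V2])
    have "(W x)\<^sup>2 \<le> (V x)\<^sup>2" for x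
      using power_mono[OF W[of x], of 2] by simp
    then show "AE x in torus_measure. norm ((W x)\<^sup>2) \<le> norm ((V x)\<^sup>2)" by simp
  qed measurable
  have "(\<lambda>n. \<integral>x. (U n x - u x)\<^sup>2 \<partial>torus_measure) \<longlonglongrightarrow> (\<integral>x. 0 \<partial>torus_measure)"
  proof (rule integral_dominated_convergence[where w="\<lambda>x. 4 * (V x)\<^sup>2"])
    have "(\<lambda>n. (U n x - u x)\<^sup>2) \<longlonglongrightarrow> 0" for x
      using tendsto_power[OF LIM_zero[OF lim[of x]], of 2] by simp
    then show "AE x in torus_measure. (\<lambda>n. (U n x - u x)\<^sup>2) \<longlonglongrightarrow> 0" by simp
    have "(U n x - u x)\<^sup>2 \<le> 4 * (V x)\<^sup>2" for n x
    proof -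
      have "\<bar>U n x - u x\<bar> \<le> 2 * V x" using le[of n x] le'[of x] by linarith
      from power_mono[OF this, of 2] show ?thesis by (simp add: power_mult_distrib)
    qed
    then show "AE x in torus_measure. norm ((U n x - u x)\<^sup>2) \<le> 4 * (V x)\<^sup>2" for n by simp
  qed (use V2 in \<open>auto\<close>)
  moreover have "(norm (torus_class (U n) - torus_class u))\<^sup>2 = (\<integral>x. (U n x - u x)\<^sup>2 \<partial>torus_measure)" for n
  proof -
    have "\<bar>U n x - u x\<bar> \<le> 2 * V x" for x using le[of n x] le'[of x] by linarith
    then have "(U n x - u x)\<^sup>2 \<le> 4 * (V x)\<^sup>2" for x
      using power_mono[of "\<bar>U n x - u x\<bar>" "2 * V x" 2] by (simp add: power_mult_distrib)
    then have "integrable torus_measure (\<lambda>x. (U n x - u x)\<^sup>2)"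
      by (intro Bochner_Integration.integrable_bound[OF integrable_mult_right[OF V2, of 4]]) auto
    then show ?thesis
      using torus_class_diff[of "U n" u] norm_torus_class[of "\<lambda>x. U n x - u x"]
      by (simp add: sq le le')
  qed
  ultimately have "(\<lambda>n. (norm (torus_class (U n) - torus_class u))\<^sup>2) \<longlonglongrightarrow> 0" by simp
  then have "(\<lambda>n. sqrt ((norm (torus_class (U n) - torus_class u))\<^sup>2)) \<longlonglongrightarrow> sqrt 0"
    by (rule tendsto_real_sqrt)
  then have "(\<lambda>n. norm (torus_class (U n) - torus_class u)) \<longlonglongrightarrow> 0" by simp
  then show ?thesis
    by (simp add: tendsto_norm_zero_iff LIM_zero_iff)
qed

lemma torus_L2_countable_dense: "\<exists>D::torus_L2 set. countable D \<and> closure D = UNIV"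
proof -
  obtain B :: "(real^2) set set" where B: "countable B" "topological_basis B"
    using ex_countable_basis by blast
  define G where "G = Inter ` {b. finite b \<and> b \<subseteq> B}"
  have G_countable: "countable G"
    unfolding G_def using countable_Collect_finite_subset[OF B(1)] by simp
  have G_Int: "Int_stable G"
  proof (rule Int_stableI)
    fix a b assume "a \<in> G" "b \<in> G"
    then obtain a' b' where "a = \<Inter>a'" "finite a'" "a' \<subseteq> B" "b = \<Inter>b'" "finite b'" "b' \<subseteq> B"
      by (auto simp: G_def)
    then show "a \<inter> b \<in> G"
      unfolding G_def by (intro image_eqI[of _ _ "a' \<union> b'"]) auto
  qed
  have G_Pow: "G \<subseteq> Pow UNIV" by simp
  have G_UNIV: "UNIV \<in> G"
    unfolding G_def by (intro image_eqI[of _ _ "{}"]) auto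
  have B_G: "B \<subseteq> G"
    unfolding G_def by (auto intro!: image_eqI[of _ _ "{b}" for b])
  have G_open: "open A" if "A \<in> G" for A
    using that topological_basis_open[OF B(2)] by (auto simp: G_def intro!: open_Inter)
  have sets_borel_G: "sets (borel::(real^2) measure) = sigma_sets UNIV G"
  proof
    have "sets (borel::(real^2) measure) = sigma_sets UNIV B"
      using arg_cong[OF borel_eq_countable_basis[OF B], of sets] by simp
    then show "sets borel \<subseteq> sigma_sets UNIV G"
      using sigma_sets_mono'[OF B_G] by auto
    show "sigma_sets UNIV G \<subseteq> sets (borel::(real^2) measure)"
    proof -
      have "G \<subseteq> sets borel" using G_open by auto
      from sets.sigma_sets_subset[OF this] show ?thesis by simp
    qed
  qed
  define ind :: "(real^2) set \<Rightarrow> torus_L2" where "ind A = torus_class (indicator A)" for A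
  have ind_sq: "integrable torus_measure (\<lambda>x. (indicator A x :: real)\<^sup>2)" if "A \<in> sets borel" for A
    using that by (intro torus.integrable_const_bound[where B=1])
      (auto simp: indicator_def intro!: measurable_restrict_space1)
  define D where "D = (\<lambda>l. \<Sum>(q, A)\<leftarrow>l. q *\<^sub>R ind A) ` lists (\<rat> \<times> G)"
  have D_countable: "countable D"
    unfolding D_def using G_countable countable_rat by (intro countable_image countable_lists countable_SIGMA)
  have D_add: "x + y \<in> D" if "x \<in> D" "y \<in> D" for x y
  proof -
    obtain l m where "l \<in> lists (\<rat> \<times> G)" "m \<in> lists (\<rat> \<times> G)"
      "x = (\<Sum>(q, A)\<leftarrow>l. q *\<^sub>R ind A)" "y = (\<Sum>(q, A)\<leftarrow>m. q *\<^sub>R ind A)"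
      using \<open>x \<in> D\<close> \<open>y \<in> D\<close> unfolding D_def by blast
    then show ?thesis
      unfolding D_def by (intro image_eqI[of _ _ "l @ m"]) auto
  qed
  have D_scale: "r *\<^sub>R x \<in> D" if "x \<in> D" "r \<in> \<rat>" for x r
  proof -
    obtain l where l: "l \<in> lists (\<rat> \<times> G)" "x = (\<Sum>(q, A)\<leftarrow>l. q *\<^sub>R ind A)"
      using \<open>x \<in> D\<close> unfolding D_def by blast
    have "r *\<^sub>R (\<Sum>(q, A)\<leftarrow>l. q *\<^sub>R ind A) = (\<Sum>(q, A)\<leftarrow>map (\<lambda>(q, A). (r * q, A)) l. q *\<^sub>R ind A)"
      by (induction l) (auto simp: scaleR_add_right)
    moreover have "map (\<lambda>(q, A). (r * q, A)) l \<in> lists (\<rat> \<times> G)"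
      using l(1) \<open>r \<in> \<rat>\<close> by (auto intro!: Rats_mult)
    ultimately show ?thesis
      unfolding D_def l(2) by blast
  qed
  define K where "K = closure D"
  have K_closed: "closed K" by (simp add: K_def)
  have K_add: "x + y \<in> K" if "x \<in> K" "y \<in> K" for x y
  proof -
    obtain X Y where "\<forall>n. X n \<in> D" "X \<longlonglongrightarrow> x" "\<forall>n. Y n \<in> D" "Y \<longlonglongrightarrow> y"
      using \<open>x \<in> K\<close> \<open>y \<in> K\<close> unfolding K_def closure_sequential by blast
    then show ?thesis
      unfolding K_def closure_sequential
      by (intro exI[of _ "\<lambda>n. X n + Y n"]) (auto intro: D_add tendsto_add)
  qed
  have K_scale: "c *\<^sub>R x \<in> K" if "x \<in> K" for c x
  proof -
    obtain X where "\<forall>n. X n \<in> D" "X \<longlonglongrightarrow> x"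
      using \<open>x \<in> K\<close> unfolding K_def closure_sequential by blast
    moreover obtain q where "\<forall>n. q n \<in> \<rat>" "q \<longlonglongrightarrow> c"
      using Rats_closure_real closure_sequential[of c \<rat>] by auto
    ultimately show ?thesis
      unfolding K_def closure_sequential
      by (intro exI[of _ "\<lambda>n. q n *\<^sub>R X n"]) (auto intro: D_scale tendsto_scaleR)
  qed
  have K_diff: "x - y \<in> K" if "x \<in> K" "y \<in> K" for x y
    using K_add[OF that(1) K_scale[OF that(2), of "-1"]] by simp
  have K_lim: "x \<in> K" if "\<And>n. X n \<in> K" "X \<longlonglongrightarrow> x" for X x
    using K_closed that closed_sequentially by blast
  have ind_G: "ind A \<in> K" if "A \<in> G" for A
  proof -
    have "ind A \<in> D"
      unfolding D_def using that by (intro image_eqI[of _ _ "[(1, A)]"]) auto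
    then show ?thesis using closure_subset K_def by auto
  qed
  have K_0: "0 \<in> K" using K_scale[OF ind_G[OF G_UNIV], of 0] by simp
  have ind_K: "ind A \<in> K" if "A \<in> sets borel" for A
    using G_Int G_Pow that[unfolded sets_borel_G]
  proof (induction rule: sigma_sets_induct_disjoint)
    case (basic A)
    then show ?case by (rule ind_G)
  next
    case empty
    show ?case using K_0 by (simp add: ind_def torus_class_indicator_empty)
  next
    case (compl A)
    then have [measurable]: "A \<in> sets borel" by (simp add: sets_borel_G)
    have "ind (UNIV - A) = ind UNIV - ind A"
    proof -
      have "(indicator (UNIV - A) :: real^2 \<Rightarrow> real) = (\<lambda>x. indicator UNIV x - indicator A x)"
        by (auto simp: indicator_def fun_eq_iff)
      then show ?thesis
        unfolding ind_def using ind_sq[of UNIV] ind_sq[of A] by (simp add: torus_class_diff)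
    qed
    then show ?case using K_diff[OF ind_G[OF G_UNIV] compl(2)] by simp
  next
    case (union A)
    then have [measurable]: "A i \<in> sets borel" for i by (auto simp: sets_borel_G)
    have fin: "torus_class (indicator (\<Union>i<n. A i)) \<in> K" for n
    proof (induction n)
      case 0
      show ?case using K_0 by (simp add: torus_class_0 torus_class_indicator_empty)
    next
      case (Suc n)
      have "(indicator (\<Union>i<Suc n. A i) :: real^2 \<Rightarrow> real) = (\<lambda>x. indicator (\<Union>i<n. A i) x + indicator (A n) x)"
      proof
        fix x
        have "x \<notin> (\<Union>i<n. A i) \<or> x \<notin> A n"
        proof (rule ccontr)
          assume "\<not> ?thesis"
          then obtain i where "i < n" "x \<in> A i" "x \<in> A n" by blast
          then show False
            using disjoint_family_onD[OF \<open>disjoint_family A\<close>, of i n] by blast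
        qed
        then show "(indicator (\<Union>i<Suc n. A i) x :: real) = indicator (\<Union>i<n. A i) x + indicator (A n) x"
          by (auto simp: indicator_def less_Suc_eq)
      qed
      then have "torus_class (indicator (\<Union>i<Suc n. A i)) = torus_class (indicator (\<Union>i<n. A i)) + ind (A n)"
        unfolding ind_def using ind_sq[of "\<Union>i<n. A i"] ind_sq[of "A n"] by (simp add: torus_class_add)
      then show ?case using Suc union(3)[of n] K_add by simp
    qed
    have "(\<lambda>n. torus_class (indicator (\<Union>i<n. A i))) \<longlonglongrightarrow> torus_class (indicator (\<Union>i. A i))"
    proof (rule torus_class_dominated[where V="\<lambda>x. 1"])
      show "(\<lambda>n. indicator (\<Union>i<n. A i) x :: real) \<longlonglongrightarrow> indicator (\<Union>i. A i) x" for x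
        by (rule LIMSEQ_indicator_UN)
    qed (auto simp: indicator_def)
    then show ?case unfolding ind_def by (rule K_lim[rotated]) (rule fin)
  qed
  have nonneg: "integrable torus_measure (\<lambda>x. (u x)\<^sup>2) \<longrightarrow> torus_class u \<in> K"
    if "u \<in> borel_measurable borel" "\<And>x. 0 \<le> u x" for u
    using that
  proof (induction rule: borel_measurable_induct_real)
    case (set A)
    then show ?case using ind_K by (simp add: ind_def)
  next
    case (mult u c)
    show ?case
    proof (cases "c = 0")
      case True
      then show ?thesis using K_0 by (simp add: torus_class_0)
    next
      case False
      show ?thesis
      proof
        assume "integrable torus_measure (\<lambda>x. (c * u x)\<^sup>2)"
        then have "integrable torus_measure (\<lambda>x. (u x)\<^sup>2)"
          using False by (simp add: power_mult_distrib)
        then show "torus_class (\<lambda>x. c * u x) \<in> K"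
          using mult K_scale by (simp add: torus_class_scaleR)
      qed
    qed
  next
    case (add u v)
    have [measurable]: "u \<in> borel_measurable borel" "v \<in> borel_measurable borel"
      using add by auto
    have [measurable]: "u \<in> borel_measurable torus_measure" "v \<in> borel_measurable torus_measure"
      by (auto intro!: measurable_restrict_space1)
    show ?case
    proof
      assume *: "integrable torus_measure (\<lambda>x. (v x + u x)\<^sup>2)"
      have u: "integrable torus_measure (\<lambda>x. (u x)\<^sup>2)"
        by (rule Bochner_Integration.integrable_bound[OF *]) (auto intro!: power_mono simp: add)
      have v: "integrable torus_measure (\<lambda>x. (v x)\<^sup>2)"
        by (rule Bochner_Integration.integrable_bound[OF *]) (auto intro!: power_mono simp: add)
      show "torus_class (\<lambda>x. v x + u x) \<in> K"
        using u v add K_add by (simp add: torus_class_add)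
    qed
  next
    case (seq U)
    have U [measurable]: "U i \<in> borel_measurable borel" for i using seq by blast
    have lim: "(\<lambda>i. U i x) \<longlonglongrightarrow> u x" for x using seq by simp
    have inc: "incseq U" using seq by blast
    have nn: "0 \<le> U i x" for i x using seq by blast
    have IH: "integrable torus_measure (\<lambda>x. (U i x)\<^sup>2) \<longrightarrow> torus_class (U i) \<in> K" for i
      using seq by blast
    have [measurable]: "u \<in> borel_measurable borel"
      by (rule borel_measurable_LIMSEQ_real[OF lim U])
    have [measurable]: "U i \<in> borel_measurable torus_measure" for i
      by (auto intro!: measurable_restrict_space1)
    have le: "U i x \<le> u x" for i x
      using inc by (intro incseq_le[OF _ lim]) (auto simp: incseq_def le_fun_def)
    show ?case
    proof
      assume *: "integrable torus_measure (\<lambda>x. (u x)\<^sup>2)"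
      have "integrable torus_measure (\<lambda>x. (U i x)\<^sup>2)" for i
        by (rule Bochner_Integration.integrable_bound[OF *]) (auto intro!: power_mono simp: nn le)
      then have "torus_class (U i) \<in> K" for i using IH by blast
      moreover have "(\<lambda>i. torus_class (U i)) \<longlonglongrightarrow> torus_class u"
        by (rule torus_class_dominated[OF _ _ * _ lim]) (use nn le in auto)
      ultimately show "torus_class u \<in> K" by (rule K_lim)
    qed
  qed
  have "f \<in> K" for f
  proof -
    define F where "F = rep_torus_L2 f"
    have F: "F \<in> square_integrable" by (simp add: F_def rep_torus_L2_square_integrable)
    note [measurable] = square_integrableD(1,2)[OF F]
    have p: "integrable torus_measure (\<lambda>x. (max 0 (F x))\<^sup>2)"
      by (rule Bochner_Integration.integrable_bound[OF square_integrableD(3)[OF F]]) (auto simp: max_def)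
    have n: "integrable torus_measure (\<lambda>x. (max 0 (- F x))\<^sup>2)"
      by (rule Bochner_Integration.integrable_bound[OF square_integrableD(3)[OF F]]) (auto simp: max_def)
    have "f = torus_class F" by (simp add: F_def torus_class_rep)
    also have "F = (\<lambda>x. max 0 (F x) - max 0 (- F x))" by (auto simp: max_def)
    also have "torus_class \<dots> = torus_class (\<lambda>x. max 0 (F x)) - torus_class (\<lambda>x. max 0 (- F x))"
      using p n by (intro torus_class_diff) auto
    also have "\<dots> \<in> K"
      using nonneg[of "\<lambda>x. max 0 (F x)"] nonneg[of "\<lambda>x. max 0 (- F x)"] p n by (intro K_diff) auto
    finally show ?thesis .
  qed
  then show ?thesis using D_countable K_def by auto
qed

instance torus_L2 :: second_countable_topology
proof
  obtain D :: "torus_L2 set" where D: "countable D" "closure D = UNIV"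
    using torus_L2_countable_dense by blast
  define B where "B = (\<lambda>(x, n). ball x (1 / real (Suc n))) ` (D \<times> UNIV)"
  have "topological_basis B"
  proof (rule topological_basisI)
    show "open A" if "A \<in> B" for A using that by (auto simp: B_def)
    fix U and x :: torus_L2 assume "open U" "x \<in> U"
    then obtain e where e: "e > 0" "ball x e \<subseteq> U" by (auto simp: open_contains_ball)
    obtain n where n: "1 / real (Suc n) < e / 2"
      using nat_approx_posE[of "e / 2"] half_gt_zero[OF e(1)] by metis
    obtain d where d: "d \<in> D" "dist d x < 1 / real (Suc n)"
    proof -
      have "\<forall>e>0. \<exists>y\<in>D. dist y x < e" using D(2) closure_approachable[of x D] by simp
      then have "\<exists>y\<in>D. dist y x < 1 / real (Suc n)" by (rule allE) auto
      then show ?thesis using that by blast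
    qed
    have "ball d (1 / real (Suc n)) \<subseteq> ball x e"
    proof
      fix y assume "y \<in> ball d (1 / real (Suc n))"
      then show "y \<in> ball x e"
        using d(2) n dist_triangle[of x y d] by (simp add: dist_commute)
    qed
    then show "\<exists>A\<in>B. x \<in> A \<and> A \<subseteq> U"
      using d e(2) by (intro bexI[of _ "ball d (1 / real (Suc n))"]) (auto simp: B_def)
  qed
  moreover have "countable B"
    using D(1) by (auto simp: B_def intro!: countable_image countable_SIGMA)
  ultimately show "\<exists>B::torus_L2 set set. countable B \<and> open = generate_topology B"
    using topological_basis_imp_subbasis by blast
qed


section \<open>Weak derivatives and Sobolev spaces\<close>

definition partial_deriv :: "2 \<Rightarrow> (real^2 \<Rightarrow> real) \<Rightarrow> real^2 \<Rightarrow> real"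
  where "partial_deriv i \<phi> x = frechet_derivative \<phi> (at x) (axis i 1)"

definition multi_deriv :: "nat \<times> nat \<Rightarrow> (real^2 \<Rightarrow> real) \<Rightarrow> real^2 \<Rightarrow> real"
  where "multi_deriv \<alpha> \<phi> = (partial_deriv 1 ^^ fst \<alpha>) ((partial_deriv 2 ^^ snd \<alpha>) \<phi>)"

definition smooth_fun :: "(real^2 \<Rightarrow> real) \<Rightarrow> bool"
  where "smooth_fun \<phi> \<longleftrightarrow> (\<forall>js x. foldr partial_deriv js \<phi> differentiable (at x))"

definition test_fun :: "(real^2 \<Rightarrow> real) \<Rightarrow> bool"
  where "test_fun \<phi> \<longleftrightarrow> smooth_fun \<phi> \<and> compact (closure {x. \<phi> x \<noteq> 0})"

definition locally_integrable :: "(real^2 \<Rightarrow> real) \<Rightarrow> bool"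
  where "locally_integrable g \<longleftrightarrow> (\<forall>K. compact K \<longrightarrow> set_integrable lborel K g)"

definition has_weak_deriv :: "nat \<times> nat \<Rightarrow> (real^2 \<Rightarrow> real) \<Rightarrow> (real^2 \<Rightarrow> real) \<Rightarrow> bool"
  where "has_weak_deriv \<alpha> g w \<longleftrightarrow> locally_integrable g \<and> locally_integrable w \<and>
    (\<forall>\<phi>. test_fun \<phi> \<longrightarrow>
      (\<integral>x. g x * multi_deriv \<alpha> \<phi> x \<partial>lborel) = (-1) ^ (fst \<alpha> + snd \<alpha>) * (\<integral>x. w x * \<phi> x \<partial>lborel))"

(* Weak derivatives are unique almost everywhere, so the choice is immaterial. They are taken on
   the whole plane; for the periodic extension of a function on the torus these are the weak
   derivatives on the torus. *)

definition weak_deriv :: "nat \<times> nat \<Rightarrow> (real^2 \<Rightarrow> real) \<Rightarrow> real^2 \<Rightarrow> real"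
  where "weak_deriv \<alpha> g = (SOME w. has_weak_deriv \<alpha> g w)"

definition torus_deriv :: "nat \<times> nat \<Rightarrow> torus_L2 \<Rightarrow> torus_L2"
  where "torus_deriv \<alpha> g = torus_class (weak_deriv \<alpha> (rep_torus_L2 g))"

definition multi_indices :: "nat \<Rightarrow> (nat \<times> nat) set"
  where "multi_indices k = {(m, n). m + n \<le> k}"

definition sobolev :: "nat \<Rightarrow> torus_L2 set"
  where "sobolev k = {g. \<forall>\<alpha>\<in>multi_indices k. \<exists>w. has_weak_deriv \<alpha> (rep_torus_L2 g) (rep_torus_L2 w)}"

definition sobolev_norm :: "nat \<Rightarrow> torus_L2 \<Rightarrow> real"
  where "sobolev_norm k g = sqrt (\<Sum>\<alpha>\<in>multi_indices k. (norm (torus_deriv \<alpha> g))\<^sup>2)"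

definition sobolev_inf_norm :: "nat \<Rightarrow> (real^2 \<Rightarrow> real^2) \<Rightarrow> ennreal"
  where "sobolev_inf_norm k X = (SUP \<alpha>\<in>multi_indices k.
    e2ennreal (esssup torus_measure (\<lambda>x. ereal (norm (\<chi> j. weak_deriv \<alpha> (\<lambda>y. X y $ j) x)))))"

definition sobolev_inf :: "nat \<Rightarrow> (real^2 \<Rightarrow> real^2) set"
  where "sobolev_inf k = {X. lattice_periodic X \<and> X \<in> borel_measurable borel \<and>
    (\<forall>\<alpha>\<in>multi_indices k. \<forall>j. \<exists>w. has_weak_deriv \<alpha> (\<lambda>y. X y $ j) w) \<and> sobolev_inf_norm k X < \<infinity>}"

type_synonym vel = "torus_L2 \<times> torus_L2"
type_synonym state = "vel \<times> torus_L2"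

definition sobolev_state :: "nat \<Rightarrow> state set"
  where "sobolev_state k = (sobolev k \<times> sobolev k) \<times> sobolev k"

fun state_norm :: "nat \<Rightarrow> state \<Rightarrow> real"
  where "state_norm k ((v1, v2), h) =
    sqrt ((sobolev_norm k v1)\<^sup>2 + (sobolev_norm k v2)\<^sup>2) + sobolev_norm k h"

definition sobolev_borel :: "nat \<Rightarrow> state measure"
  where "sobolev_borel k = sigma (sobolev_state k)
    {U. U \<subseteq> sobolev_state k \<and>
      (\<forall>x\<in>U. \<exists>e>0. \<forall>y\<in>sobolev_state k. state_norm k (y - x) < e \<longrightarrow> y \<in> U)}"


section \<open>Brownian motion and the Ito integral\<close>

(* Time ranges over [0, infinity], so that the library's stopping times are the extended-valued
   ones; F \<infinity> plays no role beyond lying between the F t and M. *)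

definition brownian_motion :: "'w measure \<Rightarrow> (ennreal \<Rightarrow> 'w measure) \<Rightarrow> (real \<Rightarrow> 'w \<Rightarrow> real) \<Rightarrow> bool"
  where "brownian_motion M F B \<longleftrightarrow>
    (\<forall>t\<ge>0. B t \<in> borel_measurable (F (ennreal t))) \<and>
    (AE \<omega> in M. B 0 \<omega> = 0) \<and>
    (AE \<omega> in M. continuous_on {0..} (\<lambda>t. B t \<omega>)) \<and>
    (\<forall>s t. 0 \<le> s \<longrightarrow> s < t \<longrightarrow>
      distributed M lborel (\<lambda>\<omega>. B t \<omega> - B s \<omega>) (\<lambda>x. ennreal (normal_density 0 (sqrt (t - s)) x)) \<and>
      prob_space.indep_set M (sets (F (ennreal s)))
        (sets (vimage_algebra (space M) (\<lambda>\<omega>. B t \<omega> - B s \<omega>) borel)))"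

locale stochastic_basis = prob_space M + complete_measure M + filtration "space M" F
  for M :: "'w measure" and F :: "ennreal \<Rightarrow> 'w measure" +
  fixes W :: "nat \<Rightarrow> real \<Rightarrow> 'w \<Rightarrow> real"
  assumes subalgebra: "\<And>t. sets (F t) \<subseteq> sets M"
    and null_sets_initial: "null_sets M \<subseteq> sets (F 0)"
    and right_continuous: "\<And>t. t < \<infinity> \<Longrightarrow> sets (F t) = (\<Inter>s\<in>{t<..}. sets (F s))"
    and brownian: "\<And>i. brownian_motion M F (W i)"
    and indep: "prob_space.indep_vars M (\<lambda>_. \<Pi>\<^sub>M t\<in>{0..}. borel) (\<lambda>i \<omega>. \<lambda>t\<in>{0..}. W i t \<omega>) UNIV"

definition elementary_process ::
  "'w measure \<Rightarrow> (ennreal \<Rightarrow> 'w measure) \<Rightarrow> nat \<Rightarrow> (nat \<Rightarrow> real) \<Rightarrow> (nat \<Rightarrow> 'w \<Rightarrow> 'h::real_normed_vector) \<Rightarrow> bool"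
  where "elementary_process M F n t \<zeta> \<longleftrightarrow> 0 \<le> t 0 \<and> (\<forall>k<n. t k \<le> t (Suc k)) \<and>
    (\<forall>k<n. \<zeta> k \<in> borel_measurable (F (ennreal (t k)))) \<and>
    (\<exists>c. \<forall>k<n. \<forall>\<omega>\<in>space M. norm (\<zeta> k \<omega>) \<le> c)"

definition elementary_value ::
  "nat \<Rightarrow> (nat \<Rightarrow> real) \<Rightarrow> (nat \<Rightarrow> 'w \<Rightarrow> 'h::real_normed_vector) \<Rightarrow> real \<Rightarrow> 'w \<Rightarrow> 'h"
  where "elementary_value n t \<zeta> s \<omega> = (\<Sum>k<n. indicator {t k<..t (Suc k)} s *\<^sub>R \<zeta> k \<omega>)"

definition elementary_integral ::
  "(real \<Rightarrow> 'w \<Rightarrow> real) \<Rightarrow> nat \<Rightarrow> (nat \<Rightarrow> real) \<Rightarrow> (nat \<Rightarrow> 'w \<Rightarrow> 'h::real_normed_vector) \<Rightarrow> real \<Rightarrow> 'w \<Rightarrow> 'h"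
  where "elementary_integral B n t \<zeta> T \<omega> =
    (\<Sum>k<n. (B (min T (t (Suc k))) \<omega> - B (min T (t k)) \<omega>) *\<^sub>R \<zeta> k \<omega>)"

(* Y is (a version of) the integral of G against B over [0, T]: the L^2-limit of the integrals of
   elementary processes approximating G in L^2([0, T] x Omega). *)

definition has_ito_integral ::
  "'w measure \<Rightarrow> (ennreal \<Rightarrow> 'w measure) \<Rightarrow> (real \<Rightarrow> 'w \<Rightarrow> real) \<Rightarrow>
    (real \<Rightarrow> 'w \<Rightarrow> 'h::{real_inner, banach, second_countable_topology}) \<Rightarrow> real \<Rightarrow> ('w \<Rightarrow> 'h) \<Rightarrow> bool"
  where "has_ito_integral M F B G T Y \<longleftrightarrow>
    (let P = completion (restrict_space lborel {0..T} \<Otimes>\<^sub>M M) in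
      (\<lambda>(s, \<omega>). G s \<omega>) \<in> borel_measurable P \<and> Y \<in> borel_measurable M \<and>
      (\<exists>n t \<zeta>. (\<forall>m. elementary_process M F (n m) (t m) (\<zeta> m)) \<and>
        (\<lambda>m. \<integral>\<^sup>+(s, \<omega>). ennreal ((norm (G s \<omega> - elementary_value (n m) (t m) (\<zeta> m) s \<omega>))\<^sup>2) \<partial>P) \<longlonglongrightarrow> 0 \<and>
        (\<lambda>m. \<integral>\<^sup>+\<omega>. ennreal ((norm (elementary_integral B (n m) (t m) (\<zeta> m) T \<omega> - Y \<omega>))\<^sup>2) \<partial>M) \<longlonglongrightarrow> 0))"


section \<open>The stochastic rotating shallow water system\<close>

record srsw_data =
  rossby :: real
  froude :: real
  coriolis :: real
  viscosity :: real
  diffusivity :: real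
  bottom :: torus_L2
  rotation :: "real^2 \<Rightarrow> real^2"
  noise :: "nat \<Rightarrow> real^2 \<Rightarrow> real^2"

(* The field R with curl R = f is not required to be Z^2-periodic: a periodic field has a curl of
   mean zero, so periodicity would leave only f = 0. *)

definition srsw_admissible :: "srsw_data \<Rightarrow> bool"
  where "srsw_admissible D \<longleftrightarrow>
    0 < rossby D \<and> 0 < froude D \<and> 0 < viscosity D \<and> 0 < diffusivity D \<and>
    bottom D \<in> sobolev 1 \<and>
    (\<forall>x. rotation D differentiable (at x) \<and>
      (let R' = frechet_derivative (rotation D) (at x) in
        R' (axis 1 1) $ 2 - R' (axis 2 1) $ 1 = coriolis D \<and>
        R' (axis 1 1) $ 1 + R' (axis 2 1) $ 2 = 0)) \<and>
    (\<forall>i. noise D i \<in> sobolev_inf 4 \<and>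
      (AE x in lborel. weak_deriv (1, 0) (\<lambda>y. noise D i y $ 1) x + weak_deriv (0, 1) (\<lambda>y. noise D i y $ 2) x = 0)) \<and>
    (\<Sum>i. (sobolev_inf_norm 4 (noise D i))\<^sup>2) < \<infinity>"

definition lie :: "(real^2 \<Rightarrow> real^2) \<Rightarrow> torus_L2 \<Rightarrow> torus_L2"
  where "lie X g = torus_class (\<lambda>x.
    X x $ 1 * weak_deriv (1, 0) (rep_torus_L2 g) x + X x $ 2 * weak_deriv (0, 1) (rep_torus_L2 g) x)"

fun lie_vel :: "(real^2 \<Rightarrow> real^2) \<Rightarrow> vel \<Rightarrow> vel"
  where "lie_vel X (v1, v2) = (lie X v1, lie X v2)"

fun grad_coupling :: "(real^2 \<Rightarrow> real^2) \<Rightarrow> vel \<Rightarrow> vel"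
  where "grad_coupling X (v1, v2) =
    (let d = (\<lambda>\<alpha>. torus_class (\<lambda>x. rep_torus_L2 v1 x * weak_deriv \<alpha> (\<lambda>y. X y $ 1) x
                                + rep_torus_L2 v2 x * weak_deriv \<alpha> (\<lambda>y. X y $ 2) x))
     in (d (1, 0), d (0, 1)))"

definition transport :: "(real^2 \<Rightarrow> real^2) \<Rightarrow> vel \<Rightarrow> vel"
  where "transport X v = lie_vel X v + grad_coupling X v"

(* The velocity u is determined by v = epsilon u + R. *)

fun fluid_velocity :: "srsw_data \<Rightarrow> vel \<Rightarrow> real^2 \<Rightarrow> real^2"
  where "fluid_velocity D (v1, v2) x =
    (1 / rossby D) *\<^sub>R (vector [rep_torus_L2 v1 x, rep_torus_L2 v2 x] - rotation D x)"

definition div_flux :: "torus_L2 \<Rightarrow> (real^2 \<Rightarrow> real^2) \<Rightarrow> torus_L2"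
  where "div_flux h u = torus_class (\<lambda>x.
    weak_deriv (1, 0) (\<lambda>y. rep_torus_L2 h y * u y $ 1) x + weak_deriv (0, 1) (\<lambda>y. rep_torus_L2 h y * u y $ 2) x)"

definition coriolis_term :: "srsw_data \<Rightarrow> (real^2 \<Rightarrow> real^2) \<Rightarrow> vel"
  where "coriolis_term D u =
    (torus_class (\<lambda>x. coriolis D * - (u x $ 2)), torus_class (\<lambda>x. coriolis D * u x $ 1))"

definition torus_grad :: "torus_L2 \<Rightarrow> vel"
  where "torus_grad p = (torus_deriv (1, 0) p, torus_deriv (0, 1) p)"

definition torus_laplace :: "torus_L2 \<Rightarrow> torus_L2"
  where "torus_laplace g = torus_deriv (2, 0) g + torus_deriv (0, 2) g"

definition pressure :: "srsw_data \<Rightarrow> torus_L2 \<Rightarrow> torus_L2"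
  where "pressure D h = (1 / (rossby D * froude D)) *\<^sub>R (h - bottom D)"

fun srsw_drift :: "srsw_data \<Rightarrow> state \<Rightarrow> state"
  where "srsw_drift D ((v1, v2), h) =
    (let v = (v1, v2); u = fluid_velocity D v in
      (lie_vel u v + coriolis_term D u + torus_grad (pressure D h)
         - viscosity D *\<^sub>R (torus_laplace v1, torus_laplace v2),
       div_flux h u - diffusivity D *\<^sub>R torus_laplace h))"

fun srsw_noise :: "srsw_data \<Rightarrow> nat \<Rightarrow> state \<Rightarrow> state"
  where "srsw_noise D i (v, h) = (transport (noise D i) v, lie (noise D i) h)"

(* The series converges absolutely for states in the Sobolev space of order 2. *)

definition srsw_correction :: "srsw_data \<Rightarrow> state \<Rightarrow> state"
  where "srsw_correction D a = (1/2) *\<^sub>R (\<Sum>i. srsw_noise D i (srsw_noise D i a))"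

definition stopped_at :: "('w \<Rightarrow> ennreal) \<Rightarrow> real \<Rightarrow> 'w \<Rightarrow> real"
  where "stopped_at \<tau> t \<omega> = enn2real (min (ennreal t) (\<tau> \<omega>))"

definition local_solution ::
  "'w measure \<Rightarrow> (ennreal \<Rightarrow> 'w measure) \<Rightarrow> (nat \<Rightarrow> real \<Rightarrow> 'w \<Rightarrow> real) \<Rightarrow> srsw_data \<Rightarrow> state \<Rightarrow>
    (real \<Rightarrow> 'w \<Rightarrow> state) \<Rightarrow> ('w \<Rightarrow> ennreal) \<Rightarrow> bool"
  where "local_solution M F W D a0 a \<tau> \<longleftrightarrow>
    stopping_time F \<tau> \<and> (AE \<omega> in M. 0 < \<tau> \<omega>) \<and>
    (\<forall>t\<ge>0. (\<lambda>\<omega>. a (stopped_at \<tau> t \<omega>) \<omega>) \<in> measurable (F (ennreal t)) (sobolev_borel 1)) \<and>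
    (AE \<omega> in M. \<forall>t\<ge>0.
      ((\<lambda>s. state_norm 1 (a (stopped_at \<tau> s \<omega>) \<omega> - a (stopped_at \<tau> t \<omega>) \<omega>)) \<longlongrightarrow> 0) (at t within {0..})) \<and>
    (\<forall>T>0. (\<integral>\<^sup>+\<omega>. (SUP t\<in>{0..T}. ennreal ((state_norm 1 (a (stopped_at \<tau> t \<omega>) \<omega>))\<^sup>2)) \<partial>M) < \<infinity>) \<and>
    (AE \<omega> in M. AE s in lborel. 0 \<le> s \<longrightarrow> ennreal s \<le> \<tau> \<omega> \<longrightarrow> a s \<omega> \<in> sobolev_state 2) \<and>
    (\<forall>T>0. (\<integral>\<^sup>+\<omega>. (\<integral>\<^sup>+s\<in>{0..stopped_at \<tau> T \<omega>}. ennreal ((state_norm 2 (a s \<omega>))\<^sup>2) \<partial>lborel) \<partial>M) < \<infinity>) \<and>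
    (\<exists>I S.
      (\<forall>i. \<forall>t\<ge>0. has_ito_integral M F (W i)
        (\<lambda>s \<omega>. indicator {..\<tau> \<omega>} (ennreal s) *\<^sub>R srsw_noise D i (a s \<omega>)) t (I i t)) \<and>
      (\<forall>t\<ge>0. S t \<in> borel_measurable M \<and>
        (\<lambda>n. \<integral>\<^sup>+\<omega>. ennreal ((norm ((\<Sum>i<n. I i t \<omega>) - S t \<omega>))\<^sup>2) \<partial>M) \<longlonglongrightarrow> 0) \<and>
      (AE \<omega> in M. continuous_on {0..} (\<lambda>t. S t \<omega>)) \<and>
      (AE \<omega> in M. \<forall>t\<ge>0.
        set_integrable lebesgue {0..stopped_at \<tau> t \<omega>} (\<lambda>s. srsw_drift D (a s \<omega>)) \<and>
        set_integrable lebesgue {0..stopped_at \<tau> t \<omega>} (\<lambda>s. srsw_correction D (a s \<omega>)) \<and>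
        a (stopped_at \<tau> t \<omega>) \<omega> + (LINT s:{0..stopped_at \<tau> t \<omega>}|lebesgue. srsw_drift D (a s \<omega>)) + S t \<omega>
          = a0 + (LINT s:{0..stopped_at \<tau> t \<omega>}|lebesgue. srsw_correction D (a s \<omega>))))"

(* The values of a at times t \<ge> T are irrelevant. *)

definition maximal_solution ::
  "'w measure \<Rightarrow> (ennreal \<Rightarrow> 'w measure) \<Rightarrow> (nat \<Rightarrow> real \<Rightarrow> 'w \<Rightarrow> real) \<Rightarrow> srsw_data \<Rightarrow> state \<Rightarrow>
    (real \<Rightarrow> 'w \<Rightarrow> state) \<Rightarrow> ('w \<Rightarrow> ennreal) \<Rightarrow> bool"
  where "maximal_solution M F W D a0 a T \<longleftrightarrow>
    stopping_time F T \<and>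
    (\<exists>\<tau>. (AE \<omega> in M. incseq (\<lambda>n. \<tau> n \<omega>)) \<and>
      (AE \<omega> in M. (\<lambda>n. \<tau> n \<omega>) \<longlonglongrightarrow> T \<omega>) \<and> (AE \<omega> in M. 0 < T \<omega>) \<and>
      (\<forall>n. local_solution M F W D a0 a (\<tau> n)) \<and>
      (AE \<omega> in M. T \<omega> < \<infinity> \<longrightarrow>
        Limsup (at_left (enn2real (T \<omega>))) (\<lambda>t. ereal (state_norm 1 (a t \<omega>))) = \<infinity>))"

definition exit_time :: "(real \<Rightarrow> 'w \<Rightarrow> state) \<Rightarrow> ('w \<Rightarrow> ennreal) \<Rightarrow> real \<Rightarrow> 'w \<Rightarrow> ennreal"
  where "exit_time a T R \<omega> = Inf {ennreal t |t. 0 \<le> t \<and> ennreal t < T \<omega> \<and> R < state_norm 1 (a t \<omega>)}"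

end

theory Submission
  imports Defs
begin

text \<open>
  At time zero all integrals in the integrated equation vanish, so a local solution starts almost
  surely in the initial state. Its paths are continuous in the Sobolev norm of order 1, hence the
  triangle inequality keeps that norm below any larger level for a short positive time.

  The derivatives in the norm are chosen weak derivatives, so the triangle inequality rests on their
  almost everywhere uniqueness: a locally integrable function that is orthogonal to all test
  functions has integral zero over every box, because bounded bump functions supported in the box
  converge pointwise to its indicator.
\<close>

section \<open>Test functions approximating boxes\<close>

text \<open>With \<^term>\<open>p = 1\<close> this is the classical smooth flat function; letting \<^term>\<open>p\<close> vary makes
  the family closed under differentiation.\<close>

definition flat_exp :: "real poly \<Rightarrow> real \<Rightarrow> real"
  where "flat_exp p t = (if 0 < t then poly p (1 / t) * exp (- (1 / t)) else 0)"

lemma poly_div_exp_tendsto_0: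
  fixes p :: "real poly"
  shows "((\<lambda>s. poly p s * exp (- s)) \<longlongrightarrow> 0) at_top"
proof -
  have "((\<lambda>s. \<Sum>i\<le>degree p. coeff p i * (s ^ i / exp s)) \<longlongrightarrow> (\<Sum>i\<le>degree p. coeff p i * 0)) at_top"
    by (intro tendsto_intros tendsto_power_div_exp_0)
  moreover have "(\<lambda>s. poly p s * exp (- s)) = (\<lambda>s. \<Sum>i\<le>degree p. coeff p i * (s ^ i / exp s))"
    by (simp add: poly_altdef sum_distrib_right exp_minus field_simps sum_divide_distrib)
  ultimately show ?thesis by simp
qed

text \<open>The substitution s = 1/t turns the limit from the right into the decay of a polynomial
  times exp(-s) at infinity.\<close>

lemma flat_exp_tendsto_0: "(flat_exp p \<longlongrightarrow> 0) (at 0)"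
proof -
  have "(flat_exp p \<longlongrightarrow> 0) (at_left 0)"
    by (rule Lim_transform_eventually[OF tendsto_const])
      (auto simp: flat_exp_def eventually_at_filter)
  moreover have "(flat_exp p \<longlongrightarrow> 0) (at_right 0)"
  proof (rule Lim_transform_eventually)
    show "((\<lambda>t. poly p (inverse t) * exp (- inverse t)) \<longlongrightarrow> 0) (at_right 0)"
      by (rule filterlim_compose[OF poly_div_exp_tendsto_0 filterlim_inverse_at_top_right])
  qed (auto simp: flat_exp_def eventually_at_filter inverse_eq_divide)
  ultimately show ?thesis by (simp add: filterlim_split_at)
qed

text \<open>With s = 1/t one has d/dt = -s^2 d/ds, and p(s) exp(-s) has s-derivative (p'(s) - p(s))
  exp(-s). This gives the polynomial s^2 (p - p'), where \<open>[:0, 0, 1:]\<close> is s^2.\<close>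

lemma DERIV_flat_exp:
  "(flat_exp p has_real_derivative flat_exp ([:0, 0, 1:] * (p - pderiv p)) t) (at t)"
proof (cases t "0::real" rule: linorder_cases)
  case less
  have "((\<lambda>_. 0) has_real_derivative 0) (at t)" by simp
  then show ?thesis
    by (rule DERIV_cong[OF has_field_derivative_transform_within_open[where S="{..<0}"]])
      (use less in \<open>auto simp: flat_exp_def\<close>)
next
  case equal
  \<comment> \<open>Dividing by h multiplies the polynomial in 1/h by its variable, so the
    difference quotient at 0 belongs to the same family and tends to 0.\<close>
  have "(\<lambda>h. (flat_exp p (0 + h) - flat_exp p 0) / h) = flat_exp (pCons 0 p)"
    by (auto simp: flat_exp_def fun_eq_iff)
  then have "(flat_exp p has_real_derivative 0) (at 0)"
    unfolding DERIV_def by (simp add: flat_exp_tendsto_0)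
  then show ?thesis by (simp add: equal flat_exp_def)
next
  case greater
  have "((\<lambda>t. poly p (1 / t) * exp (- (1 / t))) has_real_derivative
      flat_exp ([:0, 0, 1:] * (p - pderiv p)) t) (at t)"
    using greater
    by (auto simp: flat_exp_def field_simps power2_eq_square intro!: derivative_eq_intros)
  then show ?thesis
    by (rule has_field_derivative_transform_within_open[where S="{0<..}"])
      (use greater in \<open>auto simp: flat_exp_def\<close>)
qed

text \<open>Smoothness of a bump function is proved by placing it in a set of differentiable functions
  that is closed under partial derivatives.\<close>

inductive flat_algebra :: "(real^2 \<Rightarrow> real) \<Rightarrow> bool" where
  flat: "flat_algebra (\<lambda>x. flat_exp p (c * x $ i + d))"
| scale: "flat_algebra f \<Longrightarrow> flat_algebra (\<lambda>x. r * f x)"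
| add: "flat_algebra f \<Longrightarrow> flat_algebra g \<Longrightarrow> flat_algebra (\<lambda>x. f x + g x)"
| mult: "flat_algebra f \<Longrightarrow> flat_algebra g \<Longrightarrow> flat_algebra (\<lambda>x. f x * g x)"

text \<open>Differentiability and closure under partial derivatives are proved in one induction,
  with the same witness \<open>f'\<close> for both: the chain rule settles the generators, the
  product rule yields sums of products.\<close>

lemma flat_algebra_derivative:
  assumes "flat_algebra f"
  shows "\<exists>f'. (\<forall>x. (f has_derivative f' x) (at x)) \<and> (\<forall>j. flat_algebra (\<lambda>x. f' x (axis j 1)))"
  using assms
proof induction
  case (flat p c i d)
  let ?q = "[:0, 0, 1:] * (p - pderiv p)"
  have "((\<lambda>x. flat_exp p (c * x $ i + d)) has_derivative
      (\<lambda>h. c * h $ i * flat_exp ?q (c * x $ i + d))) (at x)" for x :: "real^2"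
  proof -
    have "((\<lambda>x::real^2. c * x $ i + d) has_derivative (\<lambda>h. c * h $ i)) (at x)"
      by (auto intro!: derivative_eq_intros bounded_linear_imp_has_derivative)
    from DERIV_compose_FDERIV[OF DERIV_flat_exp this, of p] show ?thesis .
  qed
  then show ?case
    by (intro exI[of _ "\<lambda>x h. c * h $ i * flat_exp ?q (c * x $ i + d)"] conjI allI flat_algebra.scale flat_algebra.flat)
next
  case (scale f r)
  then obtain f' where "\<And>x. (f has_derivative f' x) (at x)" "\<And>j. flat_algebra (\<lambda>x. f' x (axis j 1))"
    by blast
  then show ?case
    by (intro exI[of _ "\<lambda>x h. r * f' x h"] conjI allI has_derivative_mult_right flat_algebra.scale)
next
  case (add f g)
  then obtain f' g' where "\<And>x. (f has_derivative f' x) (at x)" "\<And>j. flat_algebra (\<lambda>x. f' x (axis j 1))"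
    and "\<And>x. (g has_derivative g' x) (at x)" "\<And>j. flat_algebra (\<lambda>x. g' x (axis j 1))"
    by blast
  then show ?case
    by (intro exI[of _ "\<lambda>x h. f' x h + g' x h"] conjI allI has_derivative_add flat_algebra.add)
next
  case (mult f g)
  then obtain f' g' where "\<And>x. (f has_derivative f' x) (at x)" "\<And>j. flat_algebra (\<lambda>x. f' x (axis j 1))"
    and "\<And>x. (g has_derivative g' x) (at x)" "\<And>j. flat_algebra (\<lambda>x. g' x (axis j 1))"
    by blast
  with mult.hyps show ?case
    by (intro exI[of _ "\<lambda>x h. f x * g' x h + f' x h * g x"] conjI allI has_derivative_mult
        flat_algebra.add flat_algebra.mult)
qed

lemma flat_algebra_smooth:
  assumes "flat_algebra f"
  shows "smooth_fun f"
proof -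
  have step: "flat_algebra (partial_deriv j f)" if f: "flat_algebra f" for f j
  proof -
    obtain f' where f': "\<And>x. (f has_derivative f' x) (at x)" "flat_algebra (\<lambda>x. f' x (axis j 1))"
      using flat_algebra_derivative[OF f] by blast
    then have "partial_deriv j f = (\<lambda>x. f' x (axis j 1))"
      by (simp add: partial_deriv_def fun_eq_iff frechet_derivative_at[OF f'(1), symmetric])
    then show ?thesis using f'(2) by simp
  qed
  have "flat_algebra (foldr partial_deriv js f)" for js
    by (induction js) (simp_all add: assms step)
  then show ?thesis
    unfolding smooth_fun_def using flat_algebra_derivative differentiable_def by blast
qed

text \<open>Inside the box each factor is exp(-1/((n+1) d)) with d the distance to a face. The
  dilation by \<open>Suc n\<close> drives it to 1 while the support stays in the closed box.\<close>

definition box_bump :: "real^2 \<Rightarrow> real^2 \<Rightarrow> nat \<Rightarrow> real^2 \<Rightarrow> real"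
  where "box_bump a b n x = (\<Prod>i\<in>UNIV. flat_exp 1 (real (Suc n) * (x $ i - a $ i)) * flat_exp 1 (real (Suc n) * (b $ i - x $ i)))"

lemma box_bump_eq_0:
  assumes "x \<notin> box a b"
  shows "box_bump a b n x = 0"
proof -
  obtain i where "x $ i \<le> a $ i \<or> b $ i \<le> x $ i"
    using assms by (auto simp: mem_box_cart not_less)
  then have "flat_exp 1 (real (Suc n) * (x $ i - a $ i)) * flat_exp 1 (real (Suc n) * (b $ i - x $ i)) = 0"
    by (auto simp: flat_exp_def zero_less_mult_iff)
  then show ?thesis
    unfolding box_bump_def by (intro prod_zero) auto
qed

lemma abs_flat_exp_1_le_1: "\<bar>flat_exp 1 t\<bar> \<le> 1"
  by (simp add: flat_exp_def)

lemma abs_box_bump_le_1: "\<bar>box_bump a b n x\<bar> \<le> 1"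
proof -
  have "\<bar>flat_exp 1 s * flat_exp 1 t\<bar> \<le> 1" for s t
    using mult_mono[OF abs_flat_exp_1_le_1[of s] abs_flat_exp_1_le_1[of t]] by (simp add: abs_mult)
  then show ?thesis
    unfolding box_bump_def abs_prod by (intro prod_le_1) auto
qed

lemma test_fun_box_bump: "test_fun (box_bump a b n)"
proof -
  \<comment> \<open>Both factors are brought into the affine form \<open>c * x $ i + d\<close> of
    the rule \<open>flat\<close>; the upper face gets a negative slope.\<close>
  have "flat_algebra (\<lambda>x. flat_exp 1 (real (Suc n) * x $ i + - (real (Suc n) * a $ i)) *
      flat_exp 1 (- real (Suc n) * x $ i + real (Suc n) * b $ i))" for i
    by (intro flat_algebra.intros)
  from mult[OF this[of 1] this[of 2]] have "flat_algebra (box_bump a b n)"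
    by (simp add: box_bump_def[abs_def] UNIV_2 algebra_simps)
  moreover have "closure {x. box_bump a b n x \<noteq> 0} \<subseteq> cbox a b"
    by (rule closure_minimal) (use box_bump_eq_0 box_subset_cbox in blast)+
  then have "compact (closure {x. box_bump a b n x \<noteq> 0})"
    using closed_Int_compact[OF closed_closure compact_cbox] by (metis Int_absorb2)
  ultimately show ?thesis
    by (simp add: test_fun_def flat_algebra_smooth)
qed

lemma flat_exp_1_tendsto_1:
  assumes "0 < t"
  shows "(\<lambda>n. flat_exp 1 (real (Suc n) * t)) \<longlonglongrightarrow> 1"
proof -
  have "(\<lambda>n. exp (- (inverse (real (Suc n)) / t))) \<longlonglongrightarrow> exp (- (0 / t))"
    using assms by (intro tendsto_intros LIMSEQ_inverse_real_of_nat) auto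
  then show ?thesis using assms by (simp add: flat_exp_def inverse_eq_divide)
qed

lemma box_bump_tendsto_indicator: "(\<lambda>n. box_bump a b n x) \<longlonglongrightarrow> indicator (box a b) x"
proof (cases "x \<in> box a b")
  case True
  then have "(\<lambda>n. box_bump a b n x) \<longlonglongrightarrow> (\<Prod>i\<in>(UNIV::2 set). 1 * 1)"
    unfolding box_bump_def
    by (intro tendsto_intros flat_exp_1_tendsto_1) (auto simp: mem_box_cart)
  then show ?thesis using True by simp
qed (simp add: box_bump_eq_0)

lemma box_bump_borel [measurable]: "box_bump a b n \<in> borel_measurable borel"
proof -
  have "isCont (flat_exp 1) t" for t
    using DERIV_flat_exp by (rule DERIV_isCont)
  then have [measurable]: "flat_exp 1 \<in> borel_measurable borel"
    by (intro borel_measurable_continuous_onI continuous_at_imp_continuous_on) auto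
  show ?thesis unfolding box_bump_def by measurable
qed

section \<open>Uniqueness of weak derivatives\<close>

text \<open>Boxes form an intersection-stable generator of the Borel sets, and the sets over which f
  integrates to zero form a Dynkin system. Hence f has integral zero over every Borel set.\<close>

lemma integral_box_eq_0_imp_AE_eq_0:
  fixes f :: "'a::euclidean_space \<Rightarrow> 'b::{banach, second_countable_topology}"
  assumes f: "integrable lborel f" and box: "\<And>a b. set_lebesgue_integral lborel (box a b) f = 0"
  shows "AE x in lborel. f x = 0"
proof (rule sigma_finite_measure.density_zero[OF sigma_finite_lborel f])
  \<comment> \<open>Closure under complements uses the integral over the whole space, obtained by
    exhausting it with centred boxes.\<close>
  have UNIV_0: "integral\<^sup>L lborel f = 0"
  proof -
    define B where "B k = box (- (real k *\<^sub>R One)) (real k *\<^sub>R One :: 'a)" for k :: nat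
    have "incseq B"
      by (auto simp: B_def incseq_def subset_box)
    then have "(\<lambda>k. set_lebesgue_integral lborel (B k) f) \<longlonglongrightarrow> set_lebesgue_integral lborel (\<Union>k. B k) f"
      by (rule set_integral_cont_up[rotated]) (simp_all add: B_def UN_box_eq_UNIV set_integrable_def f)
    moreover have "set_lebesgue_integral lborel (B k) f = 0" for k
      unfolding B_def by (rule box)
    moreover have "set_lebesgue_integral lborel (\<Union>k. B k) f = integral\<^sup>L lborel f"
      by (simp add: B_def UN_box_eq_UNIV set_lebesgue_integral_def)
    ultimately show ?thesis
      by (simp add: LIMSEQ_const_iff)
  qed
  fix A assume "A \<in> sets (lborel :: 'a measure)"
  then have A: "A \<in> sigma_sets UNIV (range (\<lambda>(a, b). box a b))"
    by (simp add: borel_eq_box)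
  have "Int_stable (range (\<lambda>(a, b). box a b :: 'a set))"
    by (auto simp: Int_stable_def box_Int_box)
  moreover have "range (\<lambda>(a, b). box a b :: 'a set) \<subseteq> Pow UNIV" by auto
  ultimately show "set_lebesgue_integral lborel A f = 0"
    using A
  proof (induction rule: sigma_sets_induct_disjoint)
    case (basic A)
    then show ?case by (auto simp: box)
  next
    case empty
    show ?case by (simp add: set_lebesgue_integral_def)
  next
    case (compl A)
    then have A: "A \<in> sets lborel" by (simp add: borel_eq_box)
    have "(\<lambda>x. indicator (UNIV - A) x *\<^sub>R f x) = (\<lambda>x. f x - indicator A x *\<^sub>R f x)"
      by (auto simp: indicator_def fun_eq_iff)
    then show ?case
      using compl(2) integrable_mult_indicator[OF A f]
      by (simp add: set_lebesgue_integral_def f UNIV_0)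
  next
    case (union A)
    then have A: "A i \<in> sets lborel" for i by (auto simp: borel_eq_box)
    have "set_lebesgue_integral lborel (\<Union>i. A i) f = (\<Sum>i. set_lebesgue_integral lborel (A i) f)"
      using A union(1) f
      by (intro lebesgue_integral_countable_add)
        (auto simp: disjoint_family_on_def set_integrable_def intro!: integrable_mult_indicator)
    then show ?case using union(3) by simp
  qed
qed

text \<open>Local integrability gives measurability only of restrictions to compact sets; the
  restrictions to growing balls are eventually constant at each point.\<close>

lemma locally_integrable_borel_measurable:
  assumes "locally_integrable w"
  shows "w \<in> borel_measurable borel"
proof (rule borel_measurable_LIMSEQ_real)
  define B where "B k = cball (0::real^2) (real k)" for k :: nat
  show "(\<lambda>x. indicator (B k) x *\<^sub>R w x) \<in> borel_measurable borel" for k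
  proof -
    have "set_integrable lborel (B k) w"
      using assms by (simp add: B_def locally_integrable_def)
    then show ?thesis
      unfolding set_integrable_def by (simp add: borel_measurable_integrable)
  qed
  show "(\<lambda>k. indicator (B k) x *\<^sub>R w x) \<longlonglongrightarrow> w x" for x
  proof (rule tendsto_eventually)
    obtain k0 :: nat where "norm x \<le> real k0" using real_arch_simple by blast
    then show "\<forall>\<^sub>F k in sequentially. indicator (B k) x *\<^sub>R w x = w x"
      by (intro eventually_sequentiallyI[of k0]) (auto simp: B_def)
  qed
qed

lemma locally_integrable_times_bounded:
  assumes "locally_integrable w" and [measurable]: "\<phi> \<in> borel_measurable borel"
    and "compact K" "\<And>x. x \<notin> K \<Longrightarrow> \<phi> x = 0" "\<And>x. \<bar>\<phi> x\<bar> \<le> C"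
  shows "integrable lborel (\<lambda>x. w x * \<phi> x)"
proof (rule Bochner_Integration.integrable_bound)
  show "integrable lborel (\<lambda>x. C * (indicator K x *\<^sub>R w x))"
    using assms unfolding locally_integrable_def set_integrable_def by simp
  have "norm (w x * \<phi> x) \<le> norm (C * (indicator K x *\<^sub>R w x))" for x
  proof (cases "x \<in> K")
    case True
    have "\<bar>\<phi> x\<bar> \<le> \<bar>C\<bar>" using assms(5)[of x] by linarith
    then show ?thesis using True by (simp add: abs_mult mult.commute mult_right_mono)
  qed (simp add: assms)
  then show "AE x in lborel. norm (w x * \<phi> x) \<le> norm (C * (indicator K x *\<^sub>R w x))" by simp
qed (use locally_integrable_borel_measurable[OF assms(1)] in measurable)

lemma locally_integrable_diff:
  "locally_integrable f \<Longrightarrow> locally_integrable g \<Longrightarrow> locally_integrable (\<lambda>x. f x - g x)"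
  unfolding locally_integrable_def by (simp add: set_integral_diff)

lemma test_fun_bounded:
  assumes "test_fun \<phi>"
  obtains K C where "compact K" "\<And>x. x \<notin> K \<Longrightarrow> \<phi> x = 0" "\<And>x. \<bar>\<phi> x\<bar> \<le> C" "\<phi> \<in> borel_measurable borel"
proof -
  \<comment> \<open>The empty list of directions gives differentiability of \<phi> itself.\<close>
  have "foldr partial_deriv [] \<phi> differentiable (at x)" for x
    using assms unfolding test_fun_def smooth_fun_def by blast
  then have "continuous_on UNIV \<phi>"
    using differentiable_imp_continuous_within by (auto simp: continuous_on_eq_continuous_within)
  moreover define K where "K = closure {x. \<phi> x \<noteq> 0}"
  moreover have "compact K" using assms by (simp add: test_fun_def K_def)
  ultimately have "bounded (\<phi> ` K)"
    by (meson compact_continuous_image compact_imp_bounded continuous_on_subset top_greatest)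
  then obtain C where C: "\<And>x. x \<in> K \<Longrightarrow> \<bar>\<phi> x\<bar> \<le> C"
    by (auto simp: bounded_iff)
  have 0: "\<phi> x = 0" if "x \<notin> K" for x
    using that closure_subset by (force simp: K_def)
  \<comment> \<open>If K is empty, C may be negative; the maximum also covers the points outside
    K.\<close>
  have "\<bar>\<phi> x\<bar> \<le> max C 0" for x
    using C[of x] 0[of x] by (cases "x \<in> K") auto
  with 0 \<open>compact K\<close> \<open>continuous_on UNIV \<phi>\<close> show ?thesis
    by (intro that) (auto intro: borel_measurable_continuous_onI)
qed

text \<open>Differentiation does not enlarge the support: off the closed support \<phi> vanishes on
  an open set, so its derivative is zero there.\<close>

lemma test_fun_partial_deriv:
  assumes "test_fun \<phi>"
  shows "test_fun (partial_deriv i \<phi>)"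
proof -
  have "{x. partial_deriv i \<phi> x \<noteq> 0} \<subseteq> closure {x. \<phi> x \<noteq> 0}"
  proof
    fix x assume "x \<in> {x. partial_deriv i \<phi> x \<noteq> 0}"
    moreover have "partial_deriv i \<phi> x = 0" if x: "x \<notin> closure {x. \<phi> x \<noteq> 0}"
    proof -
      have "(\<phi> has_derivative (\<lambda>_. 0)) (at x)"
      proof (rule has_derivative_transform_within_open)
        show "((\<lambda>_. 0) has_derivative (\<lambda>_. 0)) (at x)" by simp
        show "x \<in> - closure {x. \<phi> x \<noteq> 0}" using x by simp
        show "0 = \<phi> y" if "y \<in> - closure {x. \<phi> x \<noteq> 0}" for y
          using that closure_subset[of "{x. \<phi> x \<noteq> 0}"] by auto
      qed auto
      then show ?thesis
        by (simp add: partial_deriv_def frechet_derivative_at[symmetric])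
    qed
    ultimately show "x \<in> closure {x. \<phi> x \<noteq> 0}" by blast
  qed
  then have "closure {x. partial_deriv i \<phi> x \<noteq> 0} \<subseteq> closure {x. \<phi> x \<noteq> 0}"
    by (simp add: closure_minimal)
  then have "compact (closure {x. partial_deriv i \<phi> x \<noteq> 0})"
    using assms unfolding test_fun_def by (metis closed_Int_compact closed_closure Int_absorb2)
  moreover have "smooth_fun (partial_deriv i \<phi>)"
    unfolding smooth_fun_def
  proof (intro allI)
    fix js x
    \<comment> \<open>\<open>foldr\<close> applies the last list entry first, so the inner
      derivative is appended at the end.\<close>
    have "foldr partial_deriv (js @ [i]) \<phi> differentiable (at x)"
      using assms unfolding test_fun_def smooth_fun_def by blast
    then show "foldr partial_deriv js (partial_deriv i \<phi>) differentiable (at x)" by simp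
  qed
  ultimately show ?thesis by (simp add: test_fun_def)
qed

lemma test_fun_multi_deriv:
  assumes "test_fun \<phi>"
  shows "test_fun (multi_deriv \<alpha> \<phi>)"
proof -
  have "test_fun ((partial_deriv i ^^ n) \<psi>)" if "test_fun \<psi>" for i n \<psi>
    by (induction n) (simp_all add: that test_fun_partial_deriv)
  then show ?thesis by (simp add: multi_deriv_def assms)
qed

lemma integrable_times_test_fun:
  assumes "locally_integrable w" "test_fun \<phi>"
  shows "integrable lborel (\<lambda>x. w x * \<phi> x)"
proof -
  obtain K C where "compact K" "\<And>x. x \<notin> K \<Longrightarrow> \<phi> x = 0" "\<And>x. \<bar>\<phi> x\<bar> \<le> C" "\<phi> \<in> borel_measurable borel"
    using test_fun_bounded[OF assms(2)] by blast
  then show ?thesis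
    by (intro locally_integrable_times_bounded[OF assms(1)])
qed

lemma has_weak_deriv_diff:
  assumes "has_weak_deriv \<alpha> f v" "has_weak_deriv \<alpha> g w"
  shows "has_weak_deriv \<alpha> (\<lambda>x. f x - g x) (\<lambda>x. v x - w x)"
proof -
  have L: "locally_integrable f" "locally_integrable v" "locally_integrable g" "locally_integrable w"
    using assms by (auto simp: has_weak_deriv_def)
  have "(\<integral>x. (f x - g x) * multi_deriv \<alpha> \<phi> x \<partial>lborel) =
      (-1) ^ (fst \<alpha> + snd \<alpha>) * (\<integral>x. (v x - w x) * \<phi> x \<partial>lborel)" if \<phi>: "test_fun \<phi>" for \<phi>
  proof -
    note int = integrable_times_test_fun[OF _ \<phi>] integrable_times_test_fun[OF _ test_fun_multi_deriv[OF \<phi>]]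
    have "(\<integral>x. (f x - g x) * multi_deriv \<alpha> \<phi> x \<partial>lborel) =
        (\<integral>x. f x * multi_deriv \<alpha> \<phi> x \<partial>lborel) - (\<integral>x. g x * multi_deriv \<alpha> \<phi> x \<partial>lborel)"
      unfolding left_diff_distrib by (intro Bochner_Integration.integral_diff int L)
    also have "\<dots> = (-1) ^ (fst \<alpha> + snd \<alpha>) * ((\<integral>x. v x * \<phi> x \<partial>lborel) - (\<integral>x. w x * \<phi> x \<partial>lborel))"
      using assms \<phi> unfolding has_weak_deriv_def by (simp only: right_diff_distrib)
    also have "(\<integral>x. v x * \<phi> x \<partial>lborel) - (\<integral>x. w x * \<phi> x \<partial>lborel) = (\<integral>x. (v x - w x) * \<phi> x \<partial>lborel)"
      unfolding left_diff_distrib by (intro Bochner_Integration.integral_diff[symmetric] int L)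
    finally show ?thesis .
  qed
  then show ?thesis
    using L by (simp add: has_weak_deriv_def locally_integrable_diff)
qed

lemma fundamental_lemma_weak:
  assumes w: "locally_integrable w"
    and 0: "\<And>\<phi>. test_fun \<phi> \<Longrightarrow> (\<integral>x. w x * \<phi> x \<partial>lborel) = 0"
  shows "AE x in lborel. w x = 0"
proof -
  note [measurable] = locally_integrable_borel_measurable[OF w]
  have box: "set_lebesgue_integral lborel (box a b) w = 0" for a b
  proof -
    have "(\<lambda>n. \<integral>x. w x * box_bump a b n x \<partial>lborel) \<longlonglongrightarrow> (\<integral>x. w x * indicator (box a b) x \<partial>lborel)"
    proof (rule integral_dominated_convergence)
      \<comment> \<open>The dominating function is |w| on the closed box, since local integrability
        speaks of compact sets.\<close>
      have "set_integrable lborel (cbox a b) w"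
        using w by (simp add: locally_integrable_def)
      from integrable_norm[OF this[unfolded set_integrable_def]]
      show "integrable lborel (\<lambda>x. indicator (cbox a b) x *\<^sub>R norm (w x))"
        by (simp add: abs_mult)
      show "AE x in lborel. (\<lambda>n. w x * box_bump a b n x) \<longlonglongrightarrow> w x * indicator (box a b) x"
        by (intro AE_I2 tendsto_intros box_bump_tendsto_indicator)
      have "norm (w x * box_bump a b n x) \<le> indicator (cbox a b) x *\<^sub>R norm (w x)" for n x
      proof (cases "x \<in> box a b")
        case True
        then have "x \<in> cbox a b" using box_subset_cbox by blast
        then show ?thesis
          using abs_box_bump_le_1[of a b n x] by (simp add: abs_mult mult_left_le)
      qed (simp add: box_bump_eq_0)
      then show "AE x in lborel. norm (w x * box_bump a b n x) \<le> indicator (cbox a b) x *\<^sub>R norm (w x)" for n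
        by simp
    qed measurable
    then have "(\<integral>x. w x * indicator (box a b) x \<partial>lborel) = 0"
      unfolding 0[OF test_fun_box_bump] LIMSEQ_const_iff by simp
    then show ?thesis
      unfolding set_lebesgue_integral_def real_scaleR_def by (subst mult.commute)
  qed
  \<comment> \<open>\<open>integral_box_eq_0_imp_AE_eq_0\<close> asks for integrability over the
    whole plane, so it is applied to the truncations of w to countably many boxes exhausting the
    plane.\<close>
  have "AE x in lborel. \<forall>k::nat. indicator (box (- (real k *\<^sub>R One)) (real k *\<^sub>R One)) x *\<^sub>R w x = 0"
    unfolding AE_all_countable
  proof
    fix k :: nat
    let ?B = "box (- (real k *\<^sub>R One)) (real k *\<^sub>R One) :: (real^2) set"
    have "set_integrable lborel (cbox (- (real k *\<^sub>R One)) (real k *\<^sub>R One)) w"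
      using w by (simp add: locally_integrable_def)
    then have "set_integrable lborel ?B w"
      by (rule set_integrable_subset) (simp_all add: box_subset_cbox)
    then have "integrable lborel (\<lambda>x. indicator ?B x *\<^sub>R w x)"
      by (simp add: set_integrable_def)
    then show "AE x in lborel. indicator ?B x *\<^sub>R w x = 0"
    proof (rule integral_box_eq_0_imp_AE_eq_0)
      fix a b :: "real^2"
      show "(LINT x:box a b|lborel. indicator ?B x *\<^sub>R w x) = 0"
      proof -
        \<comment> \<open>The intersection of two boxes is a box, so the truncated function still
          integrates to zero over every box.\<close>
        obtain c d where "box a b \<inter> ?B = box c d"
          using box_Int_box by blast
        then have "indicator (box a b) x *\<^sub>R (indicator ?B x *\<^sub>R w x) = indicator (box c d) x *\<^sub>R w x" for x
          by (metis indicator_inter_arith scaleR_scaleR)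
        then show ?thesis
          using box[of c d] unfolding set_lebesgue_integral_def by (simp only:)
      qed
    qed
  qed
  then show ?thesis
  proof (rule AE_mp, intro AE_I2 impI)
    fix x :: "real^2" assume *: "\<forall>k::nat. indicator (box (- (real k *\<^sub>R One)) (real k *\<^sub>R One)) x *\<^sub>R w x = 0"
    obtain k :: nat where "x \<in> box (- (real k *\<^sub>R One)) (real k *\<^sub>R One)"
      using UN_box_eq_UNIV by blast
    then show "w x = 0" using *[rule_format, of k] by simp
  qed
qed

text \<open>The difference of two weak derivatives is a weak derivative of the zero function and is
  therefore orthogonal to all test functions.\<close>

lemma has_weak_deriv_unique:
  assumes "has_weak_deriv \<alpha> g v" "has_weak_deriv \<alpha> g w"
  shows "AE x in lborel. v x = w x"
proof -
  have "has_weak_deriv \<alpha> (\<lambda>x. 0) (\<lambda>x. v x - w x)"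
    using has_weak_deriv_diff[OF assms] by simp
  then have "AE x in lborel. v x - w x = 0"
    by (intro fundamental_lemma_weak) (auto simp: has_weak_deriv_def)
  then show ?thesis by simp
qed

section \<open>Linearity of the Sobolev derivatives\<close>

lemma lattice_periodic_int:
  assumes "lattice_periodic F"
  shows "F (x + of_int m *\<^sub>R axis i 1) = F x"
proof (induction m rule: int_induct[where k=0])
  case (step1 m)
  have "F (x + of_int (m + 1) *\<^sub>R axis i 1) = F ((x + of_int m *\<^sub>R axis i 1) + axis i 1)"
    by (simp add: algebra_simps)
  then show ?case using assms step1 by (simp add: lattice_periodic_def)
next
  case (step2 m)
  have "F (x + of_int m *\<^sub>R axis i 1) = F ((x + of_int (m - 1) *\<^sub>R axis i 1) + axis i 1)"
    by (simp add: algebra_simps)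
  also have "\<dots> = F (x + of_int (m - 1) *\<^sub>R axis i 1)"
    using assms unfolding lattice_periodic_def by blast
  finally show ?case using step2 by simp
qed simp

text \<open>The exceptional set is covered by countably many lattice translates of a null set in the
  unit cell. This carries equalities in L^2 of the torus over to the plane, where weak derivatives
  are taken.\<close>

lemma AE_lborel_lattice_periodic:
  assumes per: "lattice_periodic P" and [measurable]: "Measurable.pred borel P"
    and AE: "AE x in torus_measure. P x"
  shows "AE x in lborel. P x"
proof -
  define v :: "int \<times> int \<Rightarrow> real^2" where "v z = of_int (fst z) *\<^sub>R axis 1 1 + of_int (snd z) *\<^sub>R axis 2 1" for z
  define N where "N = {x\<in>unit_cell. \<not> P x}"
  have "AE x in lborel. x \<notin> N"
    using AE by (simp add: AE_restrict_space_iff N_def)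
  moreover have "N \<in> sets lborel"
    unfolding N_def by measurable
  ultimately have "N \<in> null_sets lborel"
    by (simp add: AE_iff_null_sets)
  then have "AE x in lborel. \<forall>z. x - v z \<notin> N"
    unfolding AE_all_countable using AE_not_in[OF null_sets_translation] by fastforce
  then show ?thesis
  proof (rule AE_mp, intro AE_I2 impI)
    fix x assume x: "\<forall>z. x - v z \<notin> N"
    \<comment> \<open>Subtracting the integer parts moves x into the half-open cell.\<close>
    define z where "z = (\<lfloor>x $ 1\<rfloor>, \<lfloor>x $ 2\<rfloor>)"
    have "x - v z \<in> unit_cell"
      by (simp add: unit_cell_def v_def z_def forall_2 axis_def) linarith
    then have "P (x - v z)" using x[rule_format, of z] by (simp add: N_def)
    also have "P (x - v z) = P (x - v z + of_int (fst z) *\<^sub>R axis 1 1)"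
      by (rule lattice_periodic_int[OF per, symmetric])
    also have "\<dots> = P (x - v z + of_int (fst z) *\<^sub>R axis 1 1 + of_int (snd z) *\<^sub>R axis 2 1)"
      by (rule lattice_periodic_int[OF per, symmetric])
    finally show "P x" by (simp add: v_def)
  qed
qed

text \<open>Representatives are chosen arbitrarily in their class, so subtraction is respected only
  almost everywhere.\<close>

lemma rep_torus_L2_diff: "AE x in lborel. rep_torus_L2 (f - g) x = rep_torus_L2 f x - rep_torus_L2 g x"
proof (rule AE_lborel_lattice_periodic)
  note sq = rep_torus_L2_square_integrable
  note [measurable] = square_integrableD(1)[OF sq]
  show "lattice_periodic (\<lambda>x. rep_torus_L2 (f - g) x = rep_torus_L2 f x - rep_torus_L2 g x)"
    using square_integrableD(4)[OF sq] by (simp add: lattice_periodic_def)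
  show "Measurable.pred borel (\<lambda>x. rep_torus_L2 (f - g) x = rep_torus_L2 f x - rep_torus_L2 g x)"
    by measurable
  show "AE x in torus_measure. rep_torus_L2 (f - g) x = rep_torus_L2 f x - rep_torus_L2 g x"
    using rep_abs_torus_L2[OF square_integrable_diff[OF sq sq], of f g]
    by (simp add: abs_torus_L2_diff[OF sq sq, symmetric] abs_rep_torus_L2)
qed

lemma locally_integrable_cong_AE:
  assumes "locally_integrable f" "AE x in lborel. f x = g x" and [measurable]: "g \<in> borel_measurable borel"
  shows "locally_integrable g"
  unfolding locally_integrable_def
proof (intro allI impI)
  fix K :: "(real^2) set" assume K: "compact K"
  then have [measurable]: "K \<in> sets borel" by (simp add: borel_compact)
  note [measurable] = locally_integrable_borel_measurable[OF assms(1)]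
  have "set_integrable lborel K f = set_integrable lborel K g"
    unfolding set_integrable_def using assms(2) by (intro integrable_cong_AE) auto
  then show "set_integrable lborel K g"
    using assms(1) K by (simp add: locally_integrable_def)
qed

lemma has_weak_deriv_cong_AE:
  assumes weak: "has_weak_deriv \<alpha> f v"
    and fg: "AE x in lborel. f x = g x" and vw: "AE x in lborel. v x = w x"
    and [measurable]: "g \<in> borel_measurable borel" "w \<in> borel_measurable borel"
  shows "has_weak_deriv \<alpha> g w"
proof -
  have loc: "locally_integrable f" "locally_integrable v"
    using weak by (auto simp: has_weak_deriv_def)
  note [measurable] = this[THEN locally_integrable_borel_measurable]
  have "(\<integral>x. g x * multi_deriv \<alpha> \<phi> x \<partial>lborel) = (-1) ^ (fst \<alpha> + snd \<alpha>) * (\<integral>x. w x * \<phi> x \<partial>lborel)"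
    if \<phi>: "test_fun \<phi>" for \<phi>
  proof -
    have meas: "\<psi> \<in> borel_measurable borel" if "test_fun \<psi>" for \<psi>
      using test_fun_bounded[OF that] by blast
    note [measurable] = meas[OF \<phi>] meas[OF test_fun_multi_deriv[OF \<phi>, of \<alpha>]]
    have "(\<integral>x. g x * multi_deriv \<alpha> \<phi> x \<partial>lborel) = (\<integral>x. f x * multi_deriv \<alpha> \<phi> x \<partial>lborel)"
      using fg by (intro integral_cong_AE) auto
    also have "\<dots> = (-1) ^ (fst \<alpha> + snd \<alpha>) * (\<integral>x. v x * \<phi> x \<partial>lborel)"
      using weak \<phi> unfolding has_weak_deriv_def by blast
    also have "(\<integral>x. v x * \<phi> x \<partial>lborel) = (\<integral>x. w x * \<phi> x \<partial>lborel)"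
      using vw by (intro integral_cong_AE) auto
    finally show ?thesis .
  qed
  then show ?thesis
    unfolding has_weak_deriv_def
    using locally_integrable_cong_AE[OF loc(1) fg] locally_integrable_cong_AE[OF loc(2) vw] by simp
qed

lemma has_weak_deriv_rep_diff:
  assumes "has_weak_deriv \<alpha> (rep_torus_L2 f) (rep_torus_L2 v)" "has_weak_deriv \<alpha> (rep_torus_L2 g) (rep_torus_L2 w)"
  shows "has_weak_deriv \<alpha> (rep_torus_L2 (f - g)) (rep_torus_L2 (v - w))"
  using has_weak_deriv_diff[OF assms]
proof (rule has_weak_deriv_cong_AE)
  show "AE x in lborel. rep_torus_L2 f x - rep_torus_L2 g x = rep_torus_L2 (f - g) x"
    using rep_torus_L2_diff[of f g] by eventually_elim simp
  show "AE x in lborel. rep_torus_L2 v x - rep_torus_L2 w x = rep_torus_L2 (v - w) x"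
    using rep_torus_L2_diff[of v w] by eventually_elim simp
qed (simp_all add: square_integrableD(1) rep_torus_L2_square_integrable)

text \<open>\<open>torus_class\<close> falls back to 0 without square integrability, so this
  property is first transferred from the representative of g to F.\<close>

lemma torus_class_eqI:
  assumes [measurable]: "F \<in> borel_measurable borel" and AE: "AE x in torus_measure. F x = rep_torus_L2 g x"
  shows "torus_class F = g"
proof -
  note G = square_integrableD[OF rep_torus_L2_square_integrable[of g]]
  note [measurable] = G(1,2)
  have [measurable]: "F \<in> borel_measurable torus_measure"
    by (auto intro: measurable_restrict_space1)
  have "integrable torus_measure (\<lambda>x. (F x)\<^sup>2) = integrable torus_measure (\<lambda>x. (rep_torus_L2 g x)\<^sup>2)"
    using AE by (intro integrable_cong_AE) auto
  then have F: "integrable torus_measure (\<lambda>x. (F x)\<^sup>2)" using G(3) by simp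
  have per: "periodize F \<in> square_integrable"
    by (rule periodize_square_integrable) (use F in auto)
  have "AE x in torus_measure. periodize F x = rep_torus_L2 g x"
    using AE AE_periodize[of F] by eventually_elim simp
  then have "abs_torus_L2 (periodize F) = abs_torus_L2 (rep_torus_L2 g)"
    by (intro abs_torus_L2_eqI per rep_torus_L2_square_integrable)
  then show ?thesis by (simp add: torus_class_def per abs_rep_torus_L2)
qed

text \<open>This removes the choice operator: a witness makes the chosen function a weak derivative,
  and uniqueness identifies its class.\<close>

lemma torus_deriv_eqI:
  assumes "has_weak_deriv \<alpha> (rep_torus_L2 g) (rep_torus_L2 w)"
  shows "torus_deriv \<alpha> g = w"
proof -
  have weak: "has_weak_deriv \<alpha> (rep_torus_L2 g) (weak_deriv \<alpha> (rep_torus_L2 g))"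
    unfolding weak_deriv_def using assms by (rule someI[of "has_weak_deriv \<alpha> (rep_torus_L2 g)"])
  have "AE x in lborel. weak_deriv \<alpha> (rep_torus_L2 g) x = rep_torus_L2 w x"
    by (rule has_weak_deriv_unique[OF weak assms])
  then have "AE x in torus_measure. weak_deriv \<alpha> (rep_torus_L2 g) x = rep_torus_L2 w x"
    by (subst AE_restrict_space_iff) (auto elim: eventually_mono)
  moreover have "weak_deriv \<alpha> (rep_torus_L2 g) \<in> borel_measurable borel"
    using weak locally_integrable_borel_measurable by (auto simp: has_weak_deriv_def)
  ultimately show ?thesis
    unfolding torus_deriv_def by (intro torus_class_eqI)
qed

lemma has_weak_deriv_torus_deriv:
  assumes "g \<in> sobolev k" "\<alpha> \<in> multi_indices k"
  shows "has_weak_deriv \<alpha> (rep_torus_L2 g) (rep_torus_L2 (torus_deriv \<alpha> g))"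
proof -
  obtain w where w: "has_weak_deriv \<alpha> (rep_torus_L2 g) (rep_torus_L2 w)"
    using assms unfolding sobolev_def by blast
  then show ?thesis by (simp add: torus_deriv_eqI[OF w])
qed

lemma torus_deriv_diff:
  assumes "f \<in> sobolev k" "g \<in> sobolev k" "\<alpha> \<in> multi_indices k"
  shows "torus_deriv \<alpha> (f - g) = torus_deriv \<alpha> f - torus_deriv \<alpha> g"
  by (rule torus_deriv_eqI[OF has_weak_deriv_rep_diff[OF
        has_weak_deriv_torus_deriv[OF assms(1,3)] has_weak_deriv_torus_deriv[OF assms(2,3)]]])

text \<open>In this form Minkowski's inequality for finite Euclidean sums applies.\<close>

lemma sobolev_norm_L2_set: "sobolev_norm k g = L2_set (\<lambda>\<alpha>. norm (torus_deriv \<alpha> g)) (multi_indices k)"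
  by (simp add: sobolev_norm_def L2_set_def)

text \<open>Membership in the Sobolev space makes \<open>torus_deriv\<close> respect the difference.
  The inequality is stated with f - g because path continuity controls the norm of
  differences.\<close>

lemma sobolev_norm_le_diff:
  assumes "f \<in> sobolev k" "g \<in> sobolev k"
  shows "sobolev_norm k f \<le> sobolev_norm k (f - g) + sobolev_norm k g"
proof -
  have "norm (torus_deriv \<alpha> f) \<le> norm (torus_deriv \<alpha> (f - g)) + norm (torus_deriv \<alpha> g)" if "\<alpha> \<in> multi_indices k" for \<alpha>
    using norm_triangle_sub[of "torus_deriv \<alpha> f" "torus_deriv \<alpha> g"] torus_deriv_diff[OF assms that] by simp
  then have "sobolev_norm k f \<le> L2_set (\<lambda>\<alpha>. norm (torus_deriv \<alpha> (f - g)) + norm (torus_deriv \<alpha> g)) (multi_indices k)"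
    unfolding sobolev_norm_L2_set by (intro L2_set_mono) auto
  also have "\<dots> \<le> sobolev_norm k (f - g) + sobolev_norm k g"
    unfolding sobolev_norm_L2_set by (rule L2_set_triangle_ineq)
  finally show ?thesis .
qed

lemma state_norm_le_diff:
  assumes "x \<in> sobolev_state k" "y \<in> sobolev_state k"
  shows "state_norm k x \<le> state_norm k (x - y) + state_norm k y"
proof -
  obtain v1 v2 h w1 w2 l where x: "x = ((v1, v2), h)" and y: "y = ((w1, w2), l)"
    by (metis surj_pair)
  have sob: "v1 \<in> sobolev k" "v2 \<in> sobolev k" "h \<in> sobolev k" "w1 \<in> sobolev k" "w2 \<in> sobolev k" "l \<in> sobolev k"
    using assms by (auto simp: x y sobolev_state_def)
  have nn: "0 \<le> sobolev_norm k g" for g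
    by (simp add: sobolev_norm_def sum_nonneg)
  have "sqrt ((sobolev_norm k v1)\<^sup>2 + (sobolev_norm k v2)\<^sup>2) \<le>
      sqrt ((sobolev_norm k (v1 - w1) + sobolev_norm k w1)\<^sup>2 + (sobolev_norm k (v2 - w2) + sobolev_norm k w2)\<^sup>2)"
    by (intro real_sqrt_le_mono add_mono power_mono sobolev_norm_le_diff sob nn)
  also have "\<dots> \<le> sqrt ((sobolev_norm k (v1 - w1))\<^sup>2 + (sobolev_norm k (v2 - w2))\<^sup>2) +
      sqrt ((sobolev_norm k w1)\<^sup>2 + (sobolev_norm k w2)\<^sup>2)"
    by (rule real_sqrt_sum_squares_triangle_ineq)
  finally show ?thesis
    using sobolev_norm_le_diff[OF sob(3,6)] by (simp add: x y)
qed

section \<open>The initial value and the exit time\<close>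

text \<open>The partition times are nonnegative, so truncation at time 0 sends both endpoints of
  each increment to 0 and the increment cancels.\<close>

lemma elementary_integral_0:
  assumes "elementary_process M F n t \<zeta>"
  shows "elementary_integral B n t \<zeta> 0 \<omega> = 0"
proof -
  have nn: "0 \<le> t k" if "k \<le> n" for k
    using that
  proof (induction k)
    case (Suc k)
    then have "0 \<le> t k" "t k \<le> t (Suc k)"
      using assms by (auto simp: elementary_process_def)
    then show ?case by linarith
  qed (use assms in \<open>simp add: elementary_process_def\<close>)
  show ?thesis
    unfolding elementary_integral_def
  proof (intro sum.neutral ballI)
    fix k assume "k \<in> {..<n}"
    then have "0 \<le> t k" "0 \<le> t (Suc k)" using nn by simp_all
    then show "(B (min 0 (t (Suc k))) \<omega> - B (min 0 (t k)) \<omega>) *\<^sub>R \<zeta> k \<omega> = 0"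
      by (simp add: min_def)
  qed
qed

text \<open>The sequence of squared distances is constant, equal to the second moment of Y, which is
  thus zero. It serves both for a single Ito integral and for the noise series.\<close>

lemma L2_limit_0_AE_0:
  fixes Y :: "'w \<Rightarrow> 'h::{real_normed_vector, second_countable_topology}"
  assumes [measurable]: "Y \<in> borel_measurable M"
    and X: "\<And>m::nat. AE \<omega> in M. X m \<omega> = 0"
    and lim: "(\<lambda>m. \<integral>\<^sup>+\<omega>. ennreal ((norm (X m \<omega> - Y \<omega>))\<^sup>2) \<partial>M) \<longlonglongrightarrow> 0"
  shows "AE \<omega> in M. Y \<omega> = 0"
proof -
  have "(\<integral>\<^sup>+\<omega>. ennreal ((norm (X m \<omega> - Y \<omega>))\<^sup>2) \<partial>M) = (\<integral>\<^sup>+\<omega>. ennreal ((norm (Y \<omega>))\<^sup>2) \<partial>M)" for m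
    by (rule nn_integral_cong_AE) (use X[of m] in eventually_elim, simp)
  then have "(\<integral>\<^sup>+\<omega>. ennreal ((norm (Y \<omega>))\<^sup>2) \<partial>M) = 0"
    using lim by (simp add: LIMSEQ_const_iff)
  then show ?thesis
    by (simp add: nn_integral_0_iff_AE ennreal_eq_0_iff)
qed

lemma has_ito_integral_0:
  assumes "has_ito_integral M F B G 0 Y"
  shows "AE \<omega> in M. Y \<omega> = 0"
proof -
  obtain n t \<zeta> where elem: "\<forall>m. elementary_process M F (n m) (t m) (\<zeta> m)"
    and lim: "(\<lambda>m. \<integral>\<^sup>+\<omega>. ennreal ((norm (elementary_integral B (n m) (t m) (\<zeta> m) 0 \<omega> - Y \<omega>))\<^sup>2) \<partial>M) \<longlonglongrightarrow> 0"
    and Y: "Y \<in> borel_measurable M"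
    using assms unfolding has_ito_integral_def Let_def by blast
  have "AE \<omega> in M. elementary_integral B (n m) (t m) (\<zeta> m) 0 \<omega> = 0" for m
    by (intro AE_I2 elementary_integral_0[OF elem[rule_format]])
  from L2_limit_0_AE_0[OF Y this lim] show ?thesis .
qed

lemma stopped_at_0 [simp]: "stopped_at \<tau> 0 \<omega> = 0"
  by (simp add: stopped_at_def)

lemma stopped_at_eq:
  assumes "0 \<le> t" "ennreal t \<le> \<tau> \<omega>"
  shows "stopped_at \<tau> t \<omega> = t"
  using assms by (simp add: stopped_at_def min_absorb1)

lemma set_lebesgue_integral_singleton:
  fixes f :: "real \<Rightarrow> 'b::{banach, second_countable_topology}"
  shows "set_lebesgue_integral lebesgue {c} f = 0"
  unfolding set_lebesgue_integral_def
proof (rule integral_eq_zero_AE)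
  have "{c} \<in> null_sets lebesgue"
    by (simp add: null_sets_completionI)
  from AE_not_in[OF this] show "AE x in lebesgue. indicator {c} x *\<^sub>R f x = 0"
    by eventually_elim simp
qed

text \<open>At t = 0 the time integrals run over the null set {0} and the stochastic integrals
  vanish, so the integrated equation reduces to the initial condition.\<close>

lemma local_solution_initial:
  assumes "local_solution M F W D a0 a \<tau>"
  shows "AE \<omega> in M. a 0 \<omega> = a0"
proof -
  obtain I S where
    ito: "\<forall>i. \<forall>t\<ge>0. has_ito_integral M F (W i)
        (\<lambda>s \<omega>. indicator {..\<tau> \<omega>} (ennreal s) *\<^sub>R srsw_noise D i (a s \<omega>)) t (I i t)" and
    S: "\<forall>t\<ge>0. S t \<in> borel_measurable M \<and>
        (\<lambda>n. \<integral>\<^sup>+\<omega>. ennreal ((norm ((\<Sum>i<n. I i t \<omega>) - S t \<omega>))\<^sup>2) \<partial>M) \<longlonglongrightarrow> 0" and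
    eq: "AE \<omega> in M. \<forall>t\<ge>0.
        set_integrable lebesgue {0..stopped_at \<tau> t \<omega>} (\<lambda>s. srsw_drift D (a s \<omega>)) \<and>
        set_integrable lebesgue {0..stopped_at \<tau> t \<omega>} (\<lambda>s. srsw_correction D (a s \<omega>)) \<and>
        a (stopped_at \<tau> t \<omega>) \<omega> + (LINT s:{0..stopped_at \<tau> t \<omega>}|lebesgue. srsw_drift D (a s \<omega>)) + S t \<omega>
          = a0 + (LINT s:{0..stopped_at \<tau> t \<omega>}|lebesgue. srsw_correction D (a s \<omega>))"
    using assms unfolding local_solution_def by blast
  \<comment> \<open>There are countably many noise terms, so their exceptional sets combine into one
    null set.\<close>
  have "AE \<omega> in M. \<forall>i. I i 0 \<omega> = 0"
    unfolding AE_all_countable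
    using ito[rule_format, OF order_refl, THEN has_ito_integral_0] by (rule allI)
  then have "AE \<omega> in M. (\<Sum>i<n. I i 0 \<omega>) = 0" for n
    by eventually_elim simp
  with S[rule_format, OF order_refl] have "AE \<omega> in M. S 0 \<omega> = 0"
    by (elim conjE) (rule L2_limit_0_AE_0)
  with eq show ?thesis
  proof eventually_elim
    case (elim \<omega>)
    from elim(1)[rule_format, OF order_refl, THEN conjunct2, THEN conjunct2] elim(2) show ?case
      by (simp only: stopped_at_0 atLeastAtMost_singleton set_lebesgue_integral_singleton add_0_right)
  qed
qed

text \<open>Measurability into \<open>sobolev_borel 1\<close> includes that all values lie in its
  carrier, so this holds for every \<omega> and not just almost surely.\<close>

lemma local_solution_sobolev_state:
  assumes "stochastic_basis M F W" "local_solution M F W D a0 a \<tau>" "\<omega> \<in> space M" "0 \<le> t"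
  shows "a (stopped_at \<tau> t \<omega>) \<omega> \<in> sobolev_state 1"
proof -
  interpret stochastic_basis M F W by fact
  have "(\<lambda>\<omega>. a (stopped_at \<tau> t \<omega>) \<omega>) \<in> measurable (F (ennreal t)) (sobolev_borel 1)"
    using assms(2,4) unfolding local_solution_def by blast
  moreover have "\<omega> \<in> space (F (ennreal t))"
    using assms(3) space_F by blast
  moreover have "space (sobolev_borel 1) = sobolev_state 1"
    unfolding sobolev_borel_def by (rule space_measure_of) blast
  ultimately show ?thesis
    using measurable_space[of "\<lambda>\<omega>. a (stopped_at \<tau> t \<omega>) \<omega>" "F (ennreal t)" "sobolev_borel 1" \<omega>]
    by (simp only:)
qed

lemma local_solution_exit_time_pos:
  assumes basis: "stochastic_basis M F W" and sol: "local_solution M F W D a0 a \<tau>"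
    and R: "state_norm 1 a0 < R"
  shows "AE \<omega> in M. 0 < exit_time a T R \<omega>"
proof -
  have "AE \<omega> in M. \<omega> \<in> space M" by simp
  moreover have "AE \<omega> in M. 0 < \<tau> \<omega>"
    using sol unfolding local_solution_def by blast
  moreover have "AE \<omega> in M. \<forall>t\<ge>0.
      ((\<lambda>s. state_norm 1 (a (stopped_at \<tau> s \<omega>) \<omega> - a (stopped_at \<tau> t \<omega>) \<omega>)) \<longlongrightarrow> 0) (at t within {0..})"
    using sol unfolding local_solution_def by blast
  moreover note local_solution_initial[OF sol]
  ultimately show ?thesis
  proof eventually_elim
    case (elim \<omega>)
    note state = local_solution_sobolev_state[OF basis sol elim(1)]
    have "((\<lambda>s. state_norm 1 (a (stopped_at \<tau> s \<omega>) \<omega> - a0)) \<longlongrightarrow> 0) (at 0 within {0..})"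
      using elim(3)[rule_format, of 0] elim(4) by simp
    \<comment> \<open>The tolerance is the positive gap between R and the norm of the initial
      state.\<close>
    then have "\<forall>\<^sub>F s in at 0 within {0..}. state_norm 1 (a (stopped_at \<tau> s \<omega>) \<omega> - a0) < R - state_norm 1 a0"
      using R by (intro order_tendstoD(2)) auto
    then obtain \<delta> where \<delta>: "0 < \<delta>" and
      close: "\<And>s. 0 \<le> s \<Longrightarrow> s \<noteq> 0 \<Longrightarrow> s < \<delta> \<Longrightarrow> state_norm 1 (a (stopped_at \<tau> s \<omega>) \<omega> - a0) < R - state_norm 1 a0"
      unfolding eventually_at by (auto simp: dist_real_def)
    have a0: "a0 \<in> sobolev_state 1"
      using state[of 0] elim(4) by simp
    \<comment> \<open>The limit within \<open>{0..}\<close> ignores the point 0 itself, which is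
      treated separately. Before \<tau> the stopped path coincides with a.\<close>
    have below: "state_norm 1 (a s \<omega>) < R" if s: "0 \<le> s" "s < \<delta>" "ennreal s < \<tau> \<omega>" for s
    proof (cases "s = 0")
      case True
      then show ?thesis using R elim(4) by simp
    next
      case False
      have "stopped_at \<tau> s \<omega> = s"
        using s by (intro stopped_at_eq) auto
      then show ?thesis
        using close[OF s(1) False s(2)] state_norm_le_diff[OF state[OF s(1)] a0] by simp
    qed
    \<comment> \<open>Every time at which the level is exceeded lies beyond \<delta> or beyond
      \<tau>; an empty set of such times has infimum infinity.\<close>
    have "min (ennreal \<delta>) (\<tau> \<omega>) \<le> exit_time a T R \<omega>"
      unfolding exit_time_def
    proof (rule Inf_greatest, clarify)
      fix t assume t: "0 \<le> t" "ennreal t < T \<omega>" "R < state_norm 1 (a t \<omega>)"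
      then have "\<not> (t < \<delta> \<and> ennreal t < \<tau> \<omega>)"
        using below[of t] by auto
      then show "min (ennreal \<delta>) (\<tau> \<omega>) \<le> ennreal t"
        using t(1) by (auto simp: min_le_iff_disj not_less ennreal_leI)
    qed
    moreover have "0 < min (ennreal \<delta>) (\<tau> \<omega>)"
      using \<delta> elim(2) by simp
    ultimately show "0 < exit_time a T R \<omega>" by (rule less_le_trans[rotated])
  qed
qed

theorem proposition18:
  fixes M :: "'w measure" and F :: "ennreal \<Rightarrow> 'w measure" and W :: "nat \<Rightarrow> real \<Rightarrow> 'w \<Rightarrow> real"
    and D :: srsw_data and a0 :: state and a :: "real \<Rightarrow> 'w \<Rightarrow> state" and T :: "'w \<Rightarrow> ennreal"
  assumes "stochastic_basis M F W"
    and "srsw_admissible D"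
    and "a0 \<in> sobolev_state 1"
    and "maximal_solution M F W D a0 a T"
  shows "(\<forall>R>0. state_norm 1 a0 < R \<longrightarrow> (AE \<omega> in M. 0 < exit_time a T R \<omega>)) \<and> (AE \<omega> in M. 0 < T \<omega>)"
proof -
  obtain \<tau> where sol: "\<forall>n. local_solution M F W D a0 a (\<tau> n)" and T: "AE \<omega> in M. 0 < T \<omega>"
    using assms(4) unfolding maximal_solution_def by blast
  \<comment> \<open>Any single member of the localizing sequence controls the path near time zero;
    positivity of the maximal time is part of \<open>maximal_solution\<close>.\<close>
  show ?thesis
    using local_solution_exit_time_pos[OF assms(1) sol[rule_format]] T by simp
qed

end
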